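(* Let $\psi$ satisfy the integrability condition (I) of the context for $p=1$ (hence for every $p\in[1,\infty]$), and let $\boldsymbol\gamma=(\gamma_{\mathfrak u})_{\mathfrak u\subseteq[1:d]}$ be a family of non-negative weights, not all zero, such that $\gamma_{\mathfrak w}>0$ implies $\gamma_{\mathfrak u}>0$ for all $\mathfrak u\subseteq\mathfrak w$. Then, for $1\le p\le q\le\infty$, $$\|\imath_{p,q,\psi,\boldsymbol\gamma}\|=\|\imath_{p,q,\psi,\boldsymbol\gamma}^{-1}\|\le C_{1,\infty,\psi,\boldsymbol\gamma}^{1/p-1/q}\cdot C_{1,1,\psi,\boldsymbol\gamma}^{1/q}\cdot C_{\infty,\infty,\psi,\boldsymbol\gamma}^{1-1/p},$$ and, for $1\le q\le p\le\infty$, $$\|\imath_{p,q,\psi,\boldsymbol\gamma}\|=\|\imath_{p,q,\psi,\boldsymbol\gamma}^{-1}\|\le C_{\infty,1,\psi,\boldsymbol\gamma}^{1/q-1/p}\cdot C_{1,1,\psi,\boldsymbol\gamma}^{1/p}\cdot C_{\infty,\infty,\psi,\boldsymbol\gamma}^{1-1/q},$$ where $1/\infty=0$ and the constants $C_{p,q,\psi,\boldsymbol\gamma}$ for $p,q\in\{1,\infty\}$ are (with $\frac00=0$) $$C_{\infty,\infty,\psi,\boldsymbol\gamma}=\max_{\mathfrak u\subseteq[1:d]}\sum_{\mathfrak v\subseteq\mathfrak u^c}m_\psi^{|\mathfrak v|}\frac{\gamma_{\mathfrak u\cup\mathfrak v}}{\gamma_{\mathfrak u}},\qquad C_{\infty,1,\psi,\boldsymbol\gamma}=\max_{\mathfrak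 v\subseteq[1:d]}\sum_{\mathfrak u\subseteq\mathfrak v}m_\psi^{|\mathfrak v|-|\mathfrak u|}\frac{\gamma_{\mathfrak v}}{\gamma_{\mathfrak u}},$$ $$C_{1,1,\psi,\boldsymbol\gamma}=\max_{\mathfrak v\subseteq[1:d]}\sum_{\mathfrak u\subseteq\mathfrak v}\kappa_\psi^{|\mathfrak v|-|\mathfrak u|}\frac{\gamma_{\mathfrak v}}{\gamma_{\mathfrak u}},\qquad C_{1,\infty,\psi,\boldsymbol\gamma}=\max_{\mathfrak u\subseteq[1:d]}\sum_{\mathfrak v\subseteq\mathfrak u^c}\kappa_\psi^{|\mathfrak v|}\frac{\gamma_{\mathfrak u\cup\mathfrak v}}{\gamma_{\mathfrak u}}.$$
   Context: Setting. $D$ is an interval, either $D=[0,T)$ with $T\in(0,\infty]$ or $D=[0,T]$ with $T\in(0,\infty)$; $\psi:D\to[0,\infty)$ is a probability density function (with respect to Lebesgue measure) that is positive almost everywhere. $d$ is a positive integer, $[1:d]=\{1,\dots,d\}$, and $\mathfrak u,\mathfrak v,\mathfrak w$ denote subsets of $[1:d]$; $\mathfrak u^c=[1:d]\setminus\mathfrak u$. For $\mathfrak u\neq\emptyset$, $D^{\mathfrak u}$ is the set of points $\boldsymbol x_{\mathfrak u}=(x_j)_{j\in\mathfrak u}$ with $x_j\in D$; functions on $D^{\mathfrak u}$ are identified with functions on $D^d$ depending only on the variables with indices in $\mathfrak u$. All functions are complex-valued (complex scalars). For $1\le p\le\infty$, $p'$ is the conjugate index, $1/p+1/p'=1$. $L_{p,\psi}(D^{\mathfrak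 u})$ is the Banach space of (classes of) functions with norm $\|g\|_{L_{p,\psi}(D^{\mathfrak u})}=\left(\int_{D^{\mathfrak u}}|g(\boldsymbol t_{\mathfrak u})|^p\prod_{j\in\mathfrak u}\psi(t_j)\,d\boldsymbol t_{\mathfrak u}\right)^{1/p}$ for $p<\infty$ and the essential supremum norm for $p=\infty$. $L_p^{\mathrm{loc}}(D)$ is the set of functions on $D$ whose restriction to $[0,x)$ is in $L_p([0,x))$ for all $x\in D$. Put $\overline\psi(t)=\int_t^T\psi(y)\,dy$. Integrability condition (I) for $p$ and $\psi$: either $p=\infty$ and $\overline\psi\in L_1(D)$; or $p<\infty$, $\psi^{-1/p}\in L_{p'}^{\mathrm{loc}}(D)$ and $\overline\psi\cdot\psi^{-1/p}\in L_{p'}(D)$. If (I) holds for $p=1$ then it holds for all $p$, and $m_\psi:=\int_D\overline\psi(t)\,dt=\int_D y\,\psi(y)\,dy\in(0,\infty)$, $\kappa_\psi:=\|\overline\psi/\psi\|_{L_\infty(D)}\in(0,\infty)$. Kernels: $K_\pitchfork(x,t)=1_{[0,x)}(t)$, $K_A(x,t)=1_{[0,x)}(t)-\overline\psi(t)$ for $x,t\in D$, and $K_{\star,\mathfrak u}(\boldsymbol x_{\mathfrak u},\boldsymbol t_{\mathfrak u})=\prod_{j\in\mathfrak u}K_\star(x_j,t_j)$ for $\star\in\{\pitchfork,A\}$. For $\mathfrak u\ne\emptyset$ and $g_{\mathfrak u}\in L_{p,\psi}(D^{\mathfrak u})$ put $T_{\star,\mathfrak u}(g_{\mathfrak u})=\int_{D^{\mathfrak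 u}}g_{\mathfrak u}(\boldsymbol t_{\mathfrak u})K_{\star,\mathfrak u}(\cdot_{\mathfrak u},\boldsymbol t_{\mathfrak u})\,d\boldsymbol t_{\mathfrak u}$. For $\mathfrak u=\emptyset$, $L_{p,\psi}(D^\emptyset)$ is the scalar field with norm $|\cdot|$ and $T_{\star,\emptyset}(c)$ is the constant function $c$. Let $F_{\star,p,\psi,\mathfrak u}=T_{\star,\mathfrak u}(L_{p,\psi}(D^{\mathfrak u}))$; the maps $T_{\star,\mathfrak u}$ are one-to-one, and $\|T_{\star,\mathfrak u}(g)\|_{F_{\star,p,\psi,\mathfrak u}}:=\|g\|_{L_{p,\psi}(D^{\mathfrak u})}$. The sum of the spaces $F_{\star,p,\psi,\mathfrak u}$ over $\mathfrak u\subseteq[1:d]$ (inside the continuous functions on $D^d$) is direct. For weights $\boldsymbol\gamma$ let $\mathfrak U_{\boldsymbol\gamma}=\{\mathfrak u\subseteq[1:d]:\gamma_{\mathfrak u}>0\}$, assumed non-empty. For $\star\in\{\pitchfork,A\}$ and $1\le q\le\infty$, $W_{\star,p,q,\psi,\boldsymbol\gamma}=\bigoplus_{\mathfrak u\in\mathfrak U_{\boldsymbol\gamma}}F_{\star,p,\psi,\mathfrak u}$, a space of functions $f=\sum_{\mathfrak u\in\mathfrak U_{\boldsymbol\gamma}}T_{\star,\mathfrak u}(g_{\star,\mathfrak u})$ on $D^d$, with norm $\|f\|_{W_{\star,p,q,\psi,\boldsymbol\gamma}}=\left(\sum_{\mathfrak u\in\mathfrak U_{\boldsymbol\gamma}}(\|g_{\star,\mathfrak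 u}\|_{L_{p,\psi}(D^{\mathfrak u})}/\gamma_{\mathfrak u})^q\right)^{1/q}$ for $q<\infty$ and the maximum over $\mathfrak u\in\mathfrak U_{\boldsymbol\gamma}$ for $q=\infty$. ($\star=\pitchfork$: anchored space; $\star=A$: ANOVA space.) Under the assumption on $\boldsymbol\gamma$ in the claim the two spaces coincide as vector spaces of functions; $\imath_{p,q,\psi,\boldsymbol\gamma}$ is the identity map from $W_{A,p,q,\psi,\boldsymbol\gamma}$ to $W_{\pitchfork,p,q,\psi,\boldsymbol\gamma}$, and norms of $\imath$ and $\imath^{-1}$ are operator norms. *)

theory Defs
  imports "HOL-Probability.Probability_Measure" "HOL-Probability.Essential_Supremum"
begin

section \<open>Exponents and Lebesgue spaces\<close>

text \<open>Exponents \<open>p\<close> range over \<open>{1..\<infinity>}\<close> in \<^typ>\<open>ennreal\<close>, where \<open>1/\<infinity> = 0\<close> and \<open>1/0 = \<infinity>\<close>.\<close>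

definition recip :: "ennreal \<Rightarrow> real" where
  "recip p = enn2real (1 / p)"

definition conj_index :: "ennreal \<Rightarrow> ennreal" where
  "conj_index p = 1 / (1 - 1 / p)"

definition Lp_space :: "'a measure \<Rightarrow> ennreal \<Rightarrow> ('a \<Rightarrow> 'b::real_normed_vector) set" where
  "Lp_space M p = {f \<in> borel_measurable M.
     if p = \<infinity> then esssup M (\<lambda>x. ennreal (norm (f x))) < \<infinity>
     else integrable M (\<lambda>x. norm (f x) powr enn2real p)}"

definition Lp_norm :: "'a measure \<Rightarrow> ennreal \<Rightarrow> ('a \<Rightarrow> 'b::real_normed_vector) \<Rightarrow> real" where
  "Lp_norm M p f =
     (if p = \<infinity> then enn2real (esssup M (\<lambda>x. ennreal (norm (f x))))
      else (LINT x|M. norm (f x) powr enn2real p) powr recip p)"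

section \<open>The interval and the density\<close>

definition interval_dom :: "real set \<Rightarrow> bool" where
  "interval_dom D \<longleftrightarrow> D = {0..} \<or> (\<exists>T>0. D = {0..<T} \<or> D = {0..T})"

abbreviation leb :: "real set \<Rightarrow> real measure" where
  "leb D \<equiv> restrict_space lborel D"

text \<open>Values of \<open>\<psi>\<close> outside \<open>D\<close> are irrelevant throughout.\<close>

definition prob_density_on :: "real set \<Rightarrow> (real \<Rightarrow> real) \<Rightarrow> bool" where
  "prob_density_on D \<psi> \<longleftrightarrow>
     \<psi> \<in> borel_measurable (leb D) \<and> (\<forall>t\<in>D. 0 \<le> \<psi> t) \<and>
     prob_space (density (leb D) (\<lambda>t. ennreal (\<psi> t))) \<and> (AE t in leb D. 0 < \<psi> t)"

definition psi_bar :: "real set \<Rightarrow> (real \<Rightarrow> real) \<Rightarrow> real \<Rightarrow> real" where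
  "psi_bar D \<psi> t = (LBINT y:(D \<inter> {t..}). \<psi> y)"

definition Lp_loc :: "real set \<Rightarrow> ennreal \<Rightarrow> (real \<Rightarrow> real) set" where
  "Lp_loc D p = {f. \<forall>x\<in>D. f \<in> Lp_space (leb {0..<x}) p}"

definition integrability_cond :: "real set \<Rightarrow> (real \<Rightarrow> real) \<Rightarrow> ennreal \<Rightarrow> bool" where
  "integrability_cond D \<psi> p \<longleftrightarrow>
     (p = \<infinity> \<and> psi_bar D \<psi> \<in> Lp_space (leb D) 1) \<or>
     (p < \<infinity> \<and> (\<lambda>t. \<psi> t powr - recip p) \<in> Lp_loc D (conj_index p) \<and>
       (\<lambda>t. psi_bar D \<psi> t * \<psi> t powr - recip p) \<in> Lp_space (leb D) (conj_index p))"

definition m_const :: "real set \<Rightarrow> (real \<Rightarrow> real) \<Rightarrow> real" where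
  "m_const D \<psi> = (LINT t|leb D. psi_bar D \<psi> t)"

definition kappa_const :: "real set \<Rightarrow> (real \<Rightarrow> real) \<Rightarrow> real" where
  "kappa_const D \<psi> = Lp_norm (leb D) \<infinity> (\<lambda>t. psi_bar D \<psi> t / \<psi> t)"

section \<open>Weighted spaces on \<open>D\<^sup>u\<close>, kernels and integral operators\<close>

text \<open>Points of \<open>D\<^sup>u\<close> are the elements of \<open>\<Pi>\<^sub>E j\<in>u. D\<close>. For \<open>u = {}\<close> the product measure is a
  unit point mass, so that the space below is the scalar field with the absolute value.\<close>

abbreviation leb_prod :: "real set \<Rightarrow> nat set \<Rightarrow> (nat \<Rightarrow> real) measure" where
  "leb_prod D u \<equiv> Pi\<^sub>M u (\<lambda>_. leb D)"

text \<open>Integrals are weighted by \<open>\<psi>\<close>, the essential supremum is not.\<close>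

definition Lp_psi_measure ::
  "real set \<Rightarrow> (real \<Rightarrow> real) \<Rightarrow> ennreal \<Rightarrow> nat set \<Rightarrow> (nat \<Rightarrow> real) measure" where
  "Lp_psi_measure D \<psi> p u =
     (if p = \<infinity> then leb_prod D u
      else density (leb_prod D u) (\<lambda>t. ennreal (\<Prod>j\<in>u. \<psi> (t j))))"

definition Lp_psi ::
  "real set \<Rightarrow> (real \<Rightarrow> real) \<Rightarrow> ennreal \<Rightarrow> nat set \<Rightarrow> ((nat \<Rightarrow> real) \<Rightarrow> complex) set" where
  "Lp_psi D \<psi> p u = Lp_space (Lp_psi_measure D \<psi> p u) p"

definition Lp_psi_norm ::
  "real set \<Rightarrow> (real \<Rightarrow> real) \<Rightarrow> ennreal \<Rightarrow> nat set \<Rightarrow> ((nat \<Rightarrow> real) \<Rightarrow> complex) \<Rightarrow> real" where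
  "Lp_psi_norm D \<psi> p u g = Lp_norm (Lp_psi_measure D \<psi> p u) p g"

datatype kind = Anchored | ANOVA

fun kernel1 :: "kind \<Rightarrow> real set \<Rightarrow> (real \<Rightarrow> real) \<Rightarrow> real \<Rightarrow> real \<Rightarrow> real" where
  "kernel1 Anchored D \<psi> x t = indicator {0..<x} t"
| "kernel1 ANOVA D \<psi> x t = indicator {0..<x} t - psi_bar D \<psi> t"

definition prod_kernel ::
  "kind \<Rightarrow> real set \<Rightarrow> (real \<Rightarrow> real) \<Rightarrow> nat set \<Rightarrow> (nat \<Rightarrow> real) \<Rightarrow> (nat \<Rightarrow> real) \<Rightarrow> real" where
  "prod_kernel k D \<psi> u x t = (\<Prod>j\<in>u. kernel1 k D \<psi> (x j) (t j))"

definition T_op ::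
  "kind \<Rightarrow> real set \<Rightarrow> (real \<Rightarrow> real) \<Rightarrow> nat set \<Rightarrow> ((nat \<Rightarrow> real) \<Rightarrow> complex) \<Rightarrow>
   (nat \<Rightarrow> real) \<Rightarrow> complex" where
  "T_op k D \<psi> u g x = (LINT t|leb_prod D u. g t * of_real (prod_kernel k D \<psi> u x t))"

section \<open>The spaces \<open>W\<close>\<close>

definition pos_weights :: "nat \<Rightarrow> (nat set \<Rightarrow> real) \<Rightarrow> nat set set" where
  "pos_weights d \<gamma> = {u. u \<subseteq> {1..d} \<and> 0 < \<gamma> u}"

text \<open>Functions on \<open>D\<^sup>d\<close> are represented extensionally, that is, as \<^term>\<open>undefined\<close> off
  \<open>D\<^sup>d\<close>.\<close>

definition is_rep ::
  "kind \<Rightarrow> real set \<Rightarrow> (real \<Rightarrow> real) \<Rightarrow> ennreal \<Rightarrow> nat \<Rightarrow> (nat set \<Rightarrow> real) \<Rightarrow>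
   ((nat \<Rightarrow> real) \<Rightarrow> complex) \<Rightarrow> (nat set \<Rightarrow> (nat \<Rightarrow> real) \<Rightarrow> complex) \<Rightarrow> bool" where
  "is_rep k D \<psi> p d \<gamma> f g \<longleftrightarrow>
     (\<forall>u\<in>pos_weights d \<gamma>. g u \<in> Lp_psi D \<psi> p u) \<and>
     f = (\<lambda>x \<in> {1..d} \<rightarrow>\<^sub>E D. \<Sum>u\<in>pos_weights d \<gamma>. T_op k D \<psi> u (g u) x)"

definition W_space ::
  "kind \<Rightarrow> real set \<Rightarrow> (real \<Rightarrow> real) \<Rightarrow> ennreal \<Rightarrow> nat \<Rightarrow> (nat set \<Rightarrow> real) \<Rightarrow>
   ((nat \<Rightarrow> real) \<Rightarrow> complex) set" where
  "W_space k D \<psi> p d \<gamma> = {f. \<exists>g. is_rep k D \<psi> p d \<gamma> f g}"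

definition family_norm ::
  "real set \<Rightarrow> (real \<Rightarrow> real) \<Rightarrow> ennreal \<Rightarrow> ennreal \<Rightarrow> nat \<Rightarrow> (nat set \<Rightarrow> real) \<Rightarrow>
   (nat set \<Rightarrow> (nat \<Rightarrow> real) \<Rightarrow> complex) \<Rightarrow> real" where
  "family_norm D \<psi> p q d \<gamma> g =
     (if q = \<infinity> then Max ((\<lambda>u. Lp_psi_norm D \<psi> p u (g u) / \<gamma> u) ` pos_weights d \<gamma>)
      else (\<Sum>u\<in>pos_weights d \<gamma>. (Lp_psi_norm D \<psi> p u (g u) / \<gamma> u) powr enn2real q) powr recip q)"

text \<open>The components of a representation are unique up to null sets, so the norm does not depend
  on the representation. It is taken to be \<open>\<infinity>\<close> outside the space, so that a finite operator norm
  of the identity map between two of these spaces includes the inclusion of the first in the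
  second.\<close>

definition W_norm ::
  "kind \<Rightarrow> real set \<Rightarrow> (real \<Rightarrow> real) \<Rightarrow> ennreal \<Rightarrow> ennreal \<Rightarrow> nat \<Rightarrow> (nat set \<Rightarrow> real) \<Rightarrow>
   ((nat \<Rightarrow> real) \<Rightarrow> complex) \<Rightarrow> ennreal" where
  "W_norm k D \<psi> p q d \<gamma> f =
     (if f \<in> W_space k D \<psi> p d \<gamma>
      then ennreal (THE r. \<exists>g. is_rep k D \<psi> p d \<gamma> f g \<and> r = family_norm D \<psi> p q d \<gamma> g)
      else \<infinity>)"

definition op_norm ::
  "'a set \<Rightarrow> ('a \<Rightarrow> ennreal) \<Rightarrow> ('b \<Rightarrow> ennreal) \<Rightarrow> ('a \<Rightarrow> 'b) \<Rightarrow> ennreal" where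
  "op_norm X norm_dom norm_cod \<Phi> = (SUP f\<in>{f\<in>X. norm_dom f \<le> 1}. norm_cod (\<Phi> f))"

text \<open>Norms of the identity map from the ANOVA to the anchored space, and of its inverse.\<close>

definition iota_norm ::
  "real set \<Rightarrow> (real \<Rightarrow> real) \<Rightarrow> ennreal \<Rightarrow> ennreal \<Rightarrow> nat \<Rightarrow> (nat set \<Rightarrow> real) \<Rightarrow> ennreal" where
  "iota_norm D \<psi> p q d \<gamma> =
     op_norm (W_space ANOVA D \<psi> p d \<gamma>)
       (W_norm ANOVA D \<psi> p q d \<gamma>) (W_norm Anchored D \<psi> p q d \<gamma>) id"

definition iota_inv_norm ::
  "real set \<Rightarrow> (real \<Rightarrow> real) \<Rightarrow> ennreal \<Rightarrow> ennreal \<Rightarrow> nat \<Rightarrow> (nat set \<Rightarrow> real) \<Rightarrow> ennreal" where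
  "iota_inv_norm D \<psi> p q d \<gamma> =
     op_norm (W_space Anchored D \<psi> p d \<gamma>)
       (W_norm Anchored D \<psi> p q d \<gamma>) (W_norm ANOVA D \<psi> p q d \<gamma>) id"

section \<open>The constants\<close>

definition C_inf_inf :: "real set \<Rightarrow> (real \<Rightarrow> real) \<Rightarrow> nat \<Rightarrow> (nat set \<Rightarrow> real) \<Rightarrow> real" where
  "C_inf_inf D \<psi> d \<gamma> = Max ((\<lambda>u. \<Sum>v\<in>Pow ({1..d} - u).
     m_const D \<psi> ^ card v * (\<gamma> (u \<union> v) / \<gamma> u)) ` Pow {1..d})"

definition C_inf_1 :: "real set \<Rightarrow> (real \<Rightarrow> real) \<Rightarrow> nat \<Rightarrow> (nat set \<Rightarrow> real) \<Rightarrow> real" where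
  "C_inf_1 D \<psi> d \<gamma> = Max ((\<lambda>v. \<Sum>u\<in>Pow v.
     m_const D \<psi> ^ (card v - card u) * (\<gamma> v / \<gamma> u)) ` Pow {1..d})"

definition C_1_1 :: "real set \<Rightarrow> (real \<Rightarrow> real) \<Rightarrow> nat \<Rightarrow> (nat set \<Rightarrow> real) \<Rightarrow> real" where
  "C_1_1 D \<psi> d \<gamma> = Max ((\<lambda>v. \<Sum>u\<in>Pow v.
     kappa_const D \<psi> ^ (card v - card u) * (\<gamma> v / \<gamma> u)) ` Pow {1..d})"

definition C_1_inf :: "real set \<Rightarrow> (real \<Rightarrow> real) \<Rightarrow> nat \<Rightarrow> (nat set \<Rightarrow> real) \<Rightarrow> real" where
  "C_1_inf D \<psi> d \<gamma> = Max ((\<lambda>u. \<Sum>v\<in>Pow ({1..d} - u).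
     kappa_const D \<psi> ^ card v * (\<gamma> (u \<union> v) / \<gamma> u)) ` Pow {1..d})"

end

theory Submission
  imports Defs
begin

text \<open>
  Expanding \<open>\<Prod>\<^sub>j (K\<^sub>\<pitchfork> - \<psi>bar)\<close> and \<open>\<Prod>\<^sub>j (K\<^sub>A + \<psi>bar)\<close> shows that
  both passages between the two decompositions have the form
  \<open>g\<^sub>u \<mapsto> \<Sum>\<^sub>w\<^sub>\<supseteq>\<^sub>u (\<plusminus>1)\<^bsup>|w - u|\<^esup> P\<^sub>w\<^sub>-\<^sub>u g\<^sub>w\<close>, where \<open>P\<^sub>v\<close> integrates the variables in \<open>v\<close> against
  \<open>\<psi>bar\<close>. The isometry \<open>g\<^sub>u \<mapsto> (-1)\<^bsup>|u|\<^esup> g\<^sub>u\<close> conjugates one map into the other, so the two norms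
  agree.

  For the bound no interpolation theorem is needed, because the operators \<open>P\<^sub>v\<close> are positive:
  Jensen's inequality and \<open>\<psi>bar \<le> \<kappa> \<psi>\<close> give \<open>\<parallel>P\<^sub>v\<parallel> \<le> (\<kappa>\<^bsup>|v|\<^esup>)\<^bsup>1/p\<^esup> (m\<^bsup>|v|\<^esup>)\<^bsup>1-1/p\<^esup>\<close> on \<open>L\<^sub>p\<close>. The norms of
  the components are thus transformed by a non-negative matrix with entries \<open>A\<^bsup>1/p\<^esup> B\<^bsup>1-1/p\<^esup>\<close>, and
  Hoelder's inequality for finite sums estimates its \<open>\<ell>\<^sub>q\<close> norm by row and column sums of \<open>A\<close> and
  \<open>B\<close>, which are the constants in the claim.

  Components are unique almost everywhere: setting the coordinates outside \<open>u\<close> to \<open>0\<close> isolates the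
  integrals of the anchored component \<open>g\<^sub>u\<close> over boxes, and the ANOVA case follows since the
  transformation is triangular.
\<close>

section \<open>Hoelder inequalities for finite sums\<close>

lemma powr_minus_1_mult: "c powr (r - 1) * c = c powr r" if "0 \<le> c" for c r :: real
  using that by (cases "c = 0") (simp_all add: powr_diff)

text \<open>Convexity of x powr r in tangent form, obtained from Young's inequality. The tangent at
  an arbitrary point \<open>c\<close> is what the integral version of Jensen's inequality needs:
  with \<open>c\<close> a weighted mean, the linear term integrates to zero.\<close>

lemma powr_tangent_le:
  fixes x c r :: real
  assumes "0 \<le> x" "0 < c" "1 \<le> r"
  shows "c powr r + r * c powr (r - 1) * (x - c) \<le> x powr r"
proof (cases "x = 0")
  case True
  have "c powr r + r * c powr (r - 1) * (x - c) = c powr r - r * (c powr (r - 1) * c)"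
    using True by simp
  also have "\<dots> = c powr r * (1 - r)"
    using assms by (subst powr_minus_1_mult) (auto simp: algebra_simps)
  also have "\<dots> \<le> 0" using assms by (simp add: mult_nonneg_nonpos)
  finally show ?thesis using True by simp
next
  case False
  then have x: "x > 0" using assms by simp
  have *: "c powr (r - 1) * c = c powr r"
    using assms by (intro powr_minus_1_mult) auto
  \<comment> \<open>Young with weights 1/r and 1 - 1/r for the numbers \<open>x powr r\<close> and
    \<open>c powr r\<close>; multiplying by \<open>r\<close> gives the tangent inequality. Young
    requires positive arguments, hence the separate case \<open>x = 0\<close>.\<close>
  have "(x powr r) powr (1/r) * (c powr r) powr (1 - 1/r) \<le> 1/r * x powr r + (1 - 1/r) * c powr r"
    using assms x by (intro Youngs_inequality_0) auto
  moreover have "(x powr r) powr (1/r) = x" "(c powr r) powr (1 - 1/r) = c powr (r - 1)"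
    using assms x by (auto simp: powr_powr algebra_simps)
  ultimately have "r * (x * c powr (r - 1)) \<le> r * (1/r * x powr r + (1 - 1/r) * c powr r)"
    using assms by (intro mult_left_mono) auto
  also have "\<dots> = x powr r + (r - 1) * c powr r"
    using assms by (simp add: field_simps)
  finally show ?thesis
    using * by (simp add: algebra_simps)
qed

text \<open>Hoelder with exponents 1/\<theta> and 1/(1 - \<theta>): after normalising both sums to
  1, Young's inequality applies term by term. The endpoints \<theta> = 0 and \<theta> = 1 are
  included, so that later no exponent has to be excluded.\<close>

lemma sum_Holder:
  fixes a b :: "'i \<Rightarrow> real"
  assumes fin: "finite I" and ab: "\<And>i. i \<in> I \<Longrightarrow> 0 \<le> a i" "\<And>i. i \<in> I \<Longrightarrow> 0 \<le> b i"
    and \<theta>: "0 \<le> \<theta>" "\<theta> \<le> 1"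
  shows "(\<Sum>i\<in>I. a i powr \<theta> * b i powr (1 - \<theta>)) \<le> (\<Sum>i\<in>I. a i) powr \<theta> * (\<Sum>i\<in>I. b i) powr (1 - \<theta>)"
proof -
  let ?A = "\<Sum>i\<in>I. a i" and ?B = "\<Sum>i\<in>I. b i"
  have nn: "0 \<le> ?A" "0 \<le> ?B" using ab by (auto intro: sum_nonneg)
  show ?thesis
  proof (cases "?A = 0 \<or> ?B = 0")
    case True
    then have "\<forall>i\<in>I. a i = 0 \<or> b i = 0"
      using ab fin by (auto simp: sum_nonneg_eq_0_iff)
    then have "(\<Sum>i\<in>I. a i powr \<theta> * b i powr (1 - \<theta>)) = 0" by (intro sum.neutral) auto
    then show ?thesis by simp
  next
    case False
    with nn have pos: "0 < ?A" "0 < ?B" by auto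
    have *: "a i powr \<theta> * b i powr (1 - \<theta>)
        \<le> ?A powr \<theta> * ?B powr (1 - \<theta>) * (\<theta> * (a i / ?A) + (1 - \<theta>) * (b i / ?B))" if i: "i \<in> I" for i
    proof (cases "a i = 0 \<or> b i = 0")
      case True
      then show ?thesis using ab[OF i] \<theta> pos by auto
    next
      case False
      with ab[OF i] have "0 < a i / ?A" "0 < b i / ?B" using pos by (auto simp: less_le)
      then have "(a i / ?A) powr \<theta> * (b i / ?B) powr (1 - \<theta>) \<le> \<theta> * (a i / ?A) + (1 - \<theta>) * (b i / ?B)"
        using \<theta> by (intro Youngs_inequality_0) auto
      then have "?A powr \<theta> * ?B powr (1 - \<theta>) * ((a i / ?A) powr \<theta> * (b i / ?B) powr (1 - \<theta>))
          \<le> ?A powr \<theta> * ?B powr (1 - \<theta>) * (\<theta> * (a i / ?A) + (1 - \<theta>) * (b i / ?B))"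
        by (intro mult_left_mono) auto
      then show ?thesis using pos ab[OF i] by (simp add: powr_divide)
    qed
    have "(\<Sum>i\<in>I. a i powr \<theta> * b i powr (1 - \<theta>))
        \<le> (\<Sum>i\<in>I. ?A powr \<theta> * ?B powr (1 - \<theta>) * (\<theta> * (a i / ?A) + (1 - \<theta>) * (b i / ?B)))"
      by (intro sum_mono *)
    also have "\<dots> = ?A powr \<theta> * ?B powr (1 - \<theta>) * (\<theta> * (?A / ?A) + (1 - \<theta>) * (?B / ?B))"
      by (simp add: sum.distrib flip: sum_distrib_left sum_divide_distrib)
    finally show ?thesis using pos by simp
  qed
qed

text \<open>Jensen's inequality for weights that need not sum to 1. It is Hoelder with \<theta> =
  1/r applied to the splitting of \<open>c i * x i\<close> into
  \<open>(c i * x i powr r) powr (1/r)\<close> and \<open>c i powr (1 - 1/r)\<close>.\<close>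

lemma powr_sum_weighted_le:
  fixes c x :: "'i \<Rightarrow> real"
  assumes fin: "finite I" and cx: "\<And>i. i \<in> I \<Longrightarrow> 0 \<le> c i" "\<And>i. i \<in> I \<Longrightarrow> 0 \<le> x i" and r: "1 \<le> r"
  shows "(\<Sum>i\<in>I. c i * x i) powr r \<le> (\<Sum>i\<in>I. c i) powr (r - 1) * (\<Sum>i\<in>I. c i * x i powr r)"
proof -
  have "c i * x i = (c i * x i powr r) powr (1/r) * c i powr (1 - 1/r)" if "i \<in> I" for i
  proof (cases "c i = 0")
    case False
    with cx[OF that] r have "(c i * x i powr r) powr (1/r) * c i powr (1 - 1/r)
        = (c i powr (1/r) * c i powr (1 - 1/r)) * x i"
      by (simp add: powr_mult powr_powr)
    also have "c i powr (1/r) * c i powr (1 - 1/r) = c i"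
      using False cx[OF that] by (simp flip: powr_add)
    finally show ?thesis by simp
  qed simp
  then have "(\<Sum>i\<in>I. c i * x i) = (\<Sum>i\<in>I. (c i * x i powr r) powr (1/r) * c i powr (1 - 1/r))"
    by (intro sum.cong) auto
  also have "\<dots> \<le> (\<Sum>i\<in>I. c i * x i powr r) powr (1/r) * (\<Sum>i\<in>I. c i) powr (1 - 1/r)"
    using r cx by (intro sum_Holder fin) auto
  finally have "(\<Sum>i\<in>I. c i * x i) powr r \<le>
      ((\<Sum>i\<in>I. c i * x i powr r) powr (1/r) * (\<Sum>i\<in>I. c i) powr (1 - 1/r)) powr r"
    using r cx by (intro powr_mono2) (auto intro!: sum_nonneg)
  also have "\<dots> = (\<Sum>i\<in>I. c i * x i powr r) * (\<Sum>i\<in>I. c i) powr (r - 1)"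
    using r cx by (simp add: powr_mult powr_powr sum_nonneg left_diff_distrib)
  finally show ?thesis by (simp add: mult.commute)
qed

section \<open>Lebesgue norms\<close>

lemma ennreal_ge_1_cases:
  assumes "1 \<le> (p::ennreal)"
  obtains "p = \<infinity>" | r where "1 \<le> r" "p = ennreal r"
  using assms by (cases p) (auto simp flip: ennreal_1)

lemma recip_ennreal: "0 < r \<Longrightarrow> recip (ennreal r) = 1 / r"
  by (simp add: recip_def divide_ennreal flip: ennreal_1)

lemma recip_top [simp]: "recip \<infinity> = 0" "recip top = 0"
  by (simp_all add: recip_def)

lemma recip_bounds:
  assumes "1 \<le> p"
  shows "0 \<le> recip p" "recip p \<le> 1"
  using assms by (auto elim!: ennreal_ge_1_cases simp: recip_ennreal)

lemma Lp_norm_nonneg: "0 \<le> Lp_norm N p f"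
  by (simp add: Lp_norm_def)

lemma powr_inverse_le_iff:
  fixes x y r :: real
  assumes "0 \<le> x" "0 \<le> y" "0 < r"
  shows "x powr (1/r) \<le> y \<longleftrightarrow> x \<le> y powr r"
proof
  assume "x powr (1/r) \<le> y"
  then have "(x powr (1/r)) powr r \<le> y powr r"
    using assms by (intro powr_mono2) auto
  then show "x \<le> y powr r" using assms by (simp add: powr_powr)
next
  assume "x \<le> y powr r"
  then have "x powr (1/r) \<le> (y powr r) powr (1/r)"
    using assms by (intro powr_mono2) auto
  then show "x powr (1/r) \<le> y" using assms by (simp add: powr_powr)
qed

text \<open>Membership and norm bound are treated together because the Bochner integral of a
  non-integrable function is 0, so that a bound on \<open>Lp_norm\<close> alone carries no
  information. The equivalent inequality for the non-negative integral needs no integrability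
  proof.\<close>

lemma Lp_finite_iff:
  assumes r: "1 \<le> r" and B: "0 \<le> B"
  shows "f \<in> Lp_space N (ennreal r) \<and> Lp_norm N (ennreal r) f \<le> B \<longleftrightarrow>
    f \<in> borel_measurable N \<and> (\<integral>\<^sup>+x. ennreal (norm (f x) powr r) \<partial>N) \<le> ennreal (B powr r)"
proof (cases "f \<in> borel_measurable N")
  case True
  note [measurable] = this
  let ?I = "LINT x|N. norm (f x) powr r"
  have I: "0 \<le> ?I" by (intro integral_nonneg_AE) auto
  have *: "Lp_norm N (ennreal r) f \<le> B \<longleftrightarrow> ?I \<le> B powr r"
  proof -
    have "Lp_norm N (ennreal r) f = ?I powr (1/r)"
      using r by (simp add: Lp_norm_def recip_ennreal)
    then show ?thesis using powr_inverse_le_iff[OF I B, of r] r by simp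
  qed
  show ?thesis
  proof (cases "integrable N (\<lambda>x. norm (f x) powr r)")
    case int: True
    then have "(\<integral>\<^sup>+x. ennreal (norm (f x) powr r) \<partial>N) = ennreal ?I"
      by (intro nn_integral_eq_integral) auto
    with * int r show ?thesis by (auto simp: Lp_space_def)
  next
    case False
    then have "(\<integral>\<^sup>+x. ennreal (norm (f x) powr r) \<partial>N) = \<infinity>"
      by (simp add: integrable_iff_bounded less_top[symmetric])
    with False r show ?thesis by (auto simp: Lp_space_def top_unique)
  qed
qed (auto simp: Lp_space_def)

text \<open>The analogue for the exponent \<infinity>. Membership again has to accompany the bound,
  since \<open>enn2real\<close> sends an infinite essential supremum to 0.\<close>

lemma Lp_top_iff:
  assumes B: "0 \<le> B"
  shows "f \<in> Lp_space N \<infinity> \<and> Lp_norm N \<infinity> f \<le> B \<longleftrightarrow>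
    f \<in> borel_measurable N \<and> (AE x in N. norm (f x) \<le> B)"
proof (cases "f \<in> borel_measurable N")
  case True
  note [measurable] = this
  let ?S = "esssup N (\<lambda>x. ennreal (norm (f x)))"
  have "?S < \<infinity> \<and> enn2real ?S \<le> B \<longleftrightarrow> ?S \<le> ennreal B"
    using B by (cases ?S) (auto simp: top_unique)
  also have "\<dots> \<longleftrightarrow> (AE x in N. ennreal (norm (f x)) \<le> ennreal B)"
  proof
    assume le: "?S \<le> ennreal B"
    show "AE x in N. ennreal (norm (f x)) \<le> ennreal B"
      using esssup_AE[of "\<lambda>x. ennreal (norm (f x))" N] by eventually_elim (use le in auto)
  qed (intro esssup_I, auto)
  finally show ?thesis using B by (simp add: Lp_space_def Lp_norm_def)
qed (auto simp: Lp_space_def)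

lemma Lp_measurable: "f \<in> Lp_space N p \<Longrightarrow> f \<in> borel_measurable N"
  by (simp add: Lp_space_def)

lemma Lp_norm_AE_cong:
  assumes [measurable]: "f \<in> borel_measurable N" "g \<in> borel_measurable N" and ae: "AE x in N. f x = g x"
  shows "Lp_norm N p f = Lp_norm N p g"
proof -
  have "esssup N (\<lambda>x. ennreal (norm (f x))) = esssup N (\<lambda>x. ennreal (norm (g x)))"
    by (intro esssup_AE_cong) (use ae in auto)
  moreover have "(LINT x|N. norm (f x) powr enn2real p) = (LINT x|N. norm (g x) powr enn2real p)"
    by (intro integral_cong_AE) (use ae in auto)
  ultimately show ?thesis by (simp add: Lp_norm_def)
qed

lemma Lp_norm_cong_norm:
  assumes "\<And>x. norm (f x) = norm (g x)"
  shows "Lp_norm N p f = Lp_norm N p g"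
  using assms by (simp add: Lp_norm_def)

text \<open>Minkowski's inequality through convexity: the sum of the \<open>f i\<close> is a
  combination of the normalised functions \<open>f i / n i\<close> with weights \<open>n i\<close>,
  so the weighted Jensen inequality holds pointwise and can then be integrated. Positive
  \<open>n i\<close> permit the division.\<close>

lemma Lp_sum_aux:
  fixes f :: "'i \<Rightarrow> 'a \<Rightarrow> 'b::{real_normed_vector, second_countable_topology}"
  assumes fin: "finite I" and r: "1 \<le> r" and n: "\<And>i. i \<in> I \<Longrightarrow> 0 < n i"
    and [measurable]: "\<And>i. i \<in> I \<Longrightarrow> f i \<in> borel_measurable N"
    and le: "\<And>i. i \<in> I \<Longrightarrow> (\<integral>\<^sup>+x. ennreal (norm (f i x) powr r) \<partial>N) \<le> ennreal (n i powr r)"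
  shows "(\<integral>\<^sup>+x. ennreal (norm (\<Sum>i\<in>I. f i x) powr r) \<partial>N) \<le> ennreal ((\<Sum>i\<in>I. n i) powr r)"
proof -
  let ?S = "\<Sum>i\<in>I. n i"
  have S: "0 \<le> ?S" using n by (intro sum_nonneg) (auto intro: less_imp_le)
  \<comment> \<open>\<open>k i\<close> is S^(r-1) * n_i^(1-r) with S the sum of the bounds; together
    with the integral bound n_i^r it contributes S^(r-1) * n_i, and these add up to S^r.\<close>
  define k where "k i = ?S powr (r - 1) * (n i * n i powr (- r))" for i
  have k: "0 \<le> k i" if "i \<in> I" for i using n[OF that] by (simp add: k_def)
  have pt: "norm (\<Sum>i\<in>I. f i x) powr r \<le> (\<Sum>i\<in>I. k i * norm (f i x) powr r)" for x
  proof -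
    have "norm (\<Sum>i\<in>I. f i x) \<le> (\<Sum>i\<in>I. norm (f i x))" by (rule norm_sum)
    also have "\<dots> = (\<Sum>i\<in>I. n i * (norm (f i x) / n i))"
      using n by (intro sum.cong) (auto simp: less_imp_neq[symmetric] dest: n)
    finally have "norm (\<Sum>i\<in>I. f i x) powr r \<le> (\<Sum>i\<in>I. n i * (norm (f i x) / n i)) powr r"
      using r by (intro powr_mono2) auto
    also have "\<dots> \<le> ?S powr (r - 1) * (\<Sum>i\<in>I. n i * (norm (f i x) / n i) powr r)"
      using n by (intro powr_sum_weighted_le fin r) (auto simp: less_imp_le)
    also have "\<dots> = (\<Sum>i\<in>I. k i * norm (f i x) powr r)"
      unfolding sum_distrib_left k_def
      using n by (intro sum.cong) (auto simp: powr_divide powr_minus_divide less_imp_le)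
    finally show ?thesis .
  qed
  have "(\<integral>\<^sup>+x. ennreal (norm (\<Sum>i\<in>I. f i x) powr r) \<partial>N)
      \<le> (\<integral>\<^sup>+x. (\<Sum>i\<in>I. ennreal (k i) * ennreal (norm (f i x) powr r)) \<partial>N)"
  proof (intro nn_integral_mono)
    fix x
    have "(\<Sum>i\<in>I. ennreal (k i) * ennreal (norm (f i x) powr r)) = ennreal (\<Sum>i\<in>I. k i * norm (f i x) powr r)"
      using k by (subst sum_ennreal[symmetric]) (auto simp: ennreal_mult)
    then show "ennreal (norm (\<Sum>i\<in>I. f i x) powr r) \<le> (\<Sum>i\<in>I. ennreal (k i) * ennreal (norm (f i x) powr r))"
      using ennreal_leI[OF pt[of x]] by simp
  qed
  also have "\<dots> = (\<Sum>i\<in>I. ennreal (k i) * (\<integral>\<^sup>+x. ennreal (norm (f i x) powr r) \<partial>N))"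
    by (simp add: nn_integral_sum nn_integral_cmult)
  also have "\<dots> \<le> (\<Sum>i\<in>I. ennreal (k i) * ennreal (n i powr r))"
    by (intro sum_mono mult_left_mono le) auto
  also have "\<dots> = ennreal (\<Sum>i\<in>I. k i * n i powr r)"
    using k by (simp flip: ennreal_mult)
  also have "(\<Sum>i\<in>I. k i * n i powr r) = (\<Sum>i\<in>I. ?S powr (r - 1) * n i)"
  proof (intro sum.cong refl)
    fix i assume "i \<in> I"
    then have "n i powr (- r) * n i powr r = 1" using n[of i] by (simp flip: powr_add)
    then show "k i * n i powr r = ?S powr (r - 1) * n i" by (simp add: k_def algebra_simps)
  qed
  also have "\<dots> = ?S powr (r - 1) * ?S" by (simp add: sum_distrib_left)
  also have "\<dots> = ?S powr r"
    using S by (rule powr_minus_1_mult)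
  finally show ?thesis .
qed

lemma Lp_sum:
  fixes f :: "'i \<Rightarrow> 'a \<Rightarrow> 'b::{real_normed_vector, second_countable_topology}"
  assumes p: "1 \<le> p" and fin: "finite I" and f: "\<And>i. i \<in> I \<Longrightarrow> f i \<in> Lp_space N p"
    and B: "\<And>i. i \<in> I \<Longrightarrow> Lp_norm N p (f i) \<le> B i"
  shows "(\<lambda>x. \<Sum>i\<in>I. f i x) \<in> Lp_space N p \<and> Lp_norm N p (\<lambda>x. \<Sum>i\<in>I. f i x) \<le> (\<Sum>i\<in>I. B i)"
proof -
  have B0: "0 \<le> B i" if "i \<in> I" for i using B[OF that] Lp_norm_nonneg order_trans by blast
  have S0: "0 \<le> (\<Sum>i\<in>I. B i)" using B0 by (rule sum_nonneg)
  note [measurable] = f[THEN Lp_measurable]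
  show ?thesis
  using p proof (cases rule: ennreal_ge_1_cases)
    case 1
    have "AE x in N. \<forall>i\<in>I. norm (f i x) \<le> B i"
      using fin f B B0 Lp_top_iff[of "B i" "f i" N for i] by (auto simp: 1 AE_ball_countable countable_finite)
    then have "AE x in N. norm (\<Sum>i\<in>I. f i x) \<le> (\<Sum>i\<in>I. B i)"
      by eventually_elim (auto intro: sum_norm_le)
    then show ?thesis unfolding 1 by (subst Lp_top_iff[OF S0]) auto
  next
    case (2 r)
    \<comment> \<open>A bound \<open>B i\<close> may be 0, while the auxiliary lemma divides by it.
      All bounds are therefore raised by \<open>e\<close>, and \<open>e\<close> tends to 0 at the
      end.\<close>
    have nn: "(\<integral>\<^sup>+x. ennreal (norm (\<Sum>i\<in>I. f i x) powr r) \<partial>N) \<le> ennreal ((\<Sum>i\<in>I. B i + e) powr r)"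
      if e: "0 < e" for e
    proof (intro Lp_sum_aux[OF fin 2(1)])
      fix i assume i: "i \<in> I"
      have "0 \<le> B i + e" using B0[OF i] e by simp
      from Lp_finite_iff[OF 2(1) this, of "f i" N] f[OF i] B[OF i] e
      show "(\<integral>\<^sup>+x. ennreal (norm (f i x) powr r) \<partial>N) \<le> ennreal ((B i + e) powr r)"
        by (simp add: 2)
      show "0 < B i + e" using B0[OF i] e by simp
    qed auto
    have *: "(\<lambda>x. \<Sum>i\<in>I. f i x) \<in> Lp_space N p \<and> Lp_norm N p (\<lambda>x. \<Sum>i\<in>I. f i x) \<le> (\<Sum>i\<in>I. B i) + card I * e"
      if e: "0 < e" for e :: real
      using nn[OF e] S0 e unfolding 2 by (subst Lp_finite_iff[OF 2(1)]) (auto simp: sum.distrib)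
    have "Lp_norm N p (\<lambda>x. \<Sum>i\<in>I. f i x) \<le> (\<Sum>i\<in>I. B i) + e" if e: "0 < e" for e :: real
    proof -
      have "card I * (e / (card I + 1)) \<le> e"
        using e by (simp add: field_simps)
      with *[of "e / (card I + 1)"] e show ?thesis by (simp add: add_pos_nonneg)
    qed
    with *[of 1] show ?thesis by (auto intro: field_le_epsilon)
  qed
qed

section \<open>Matrices on weighted sequence spaces\<close>

definition lq_norm :: "ennreal \<Rightarrow> 'i set \<Rightarrow> ('i \<Rightarrow> real) \<Rightarrow> real" where
  "lq_norm q U a = (if q = \<infinity> then Max (a ` U) else (\<Sum>u\<in>U. a u powr enn2real q) powr recip q)"

lemma lq_norm_finite: "1 \<le> s \<Longrightarrow> lq_norm (ennreal s) U a = (\<Sum>u\<in>U. a u powr s) powr (1/s)"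
  by (simp add: lq_norm_def recip_ennreal)

lemma lq_norm_nonneg:
  assumes "finite U" "U \<noteq> {}" "\<And>u. u \<in> U \<Longrightarrow> 0 \<le> a u"
  shows "0 \<le> lq_norm q U a"
  using assms by (auto simp: lq_norm_def Max_ge_iff)

lemma lq_norm_leI:
  assumes s: "1 \<le> s" and K: "0 \<le> K" and a: "\<And>u. u \<in> U \<Longrightarrow> 0 \<le> a u"
    and le: "(\<Sum>u\<in>U. b u powr s) \<le> K powr s * (\<Sum>u\<in>U. a u powr s)"
  shows "lq_norm (ennreal s) U b \<le> K * lq_norm (ennreal s) U a"
proof -
  have "(\<Sum>u\<in>U. b u powr s) powr (1/s) \<le> (K powr s * (\<Sum>u\<in>U. a u powr s)) powr (1/s)"
    using s le by (intro powr_mono2) (auto intro: sum_nonneg)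
  also have "\<dots> = K * (\<Sum>u\<in>U. a u powr s) powr (1/s)"
    using s K by (simp add: powr_mult powr_powr sum_nonneg)
  finally show ?thesis using s by (simp add: lq_norm_finite)
qed

text \<open>Strict positivity of the entries matters, since \<open>0 powr 0 = 0\<close>.\<close>

locale kernel_pair =
  fixes U :: "'i set" and R :: "'i \<Rightarrow> 'i \<Rightarrow> bool" and A B :: "'i \<Rightarrow> 'i \<Rightarrow> real"
    and Ar Ac Br Bc :: real
  assumes fin: "finite U" and ne: "U \<noteq> {}"
    and A: "\<And>u w. u \<in> U \<Longrightarrow> w \<in> U \<Longrightarrow> R u w \<Longrightarrow> 0 < A u w"
    and B: "\<And>u w. u \<in> U \<Longrightarrow> w \<in> U \<Longrightarrow> R u w \<Longrightarrow> 0 < B u w"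
    and Ar: "\<And>u. u \<in> U \<Longrightarrow> (\<Sum>w\<in>{w\<in>U. R u w}. A u w) \<le> Ar"
    and Ac: "\<And>w. w \<in> U \<Longrightarrow> (\<Sum>u\<in>{u\<in>U. R u w}. A u w) \<le> Ac"
    and Br: "\<And>u. u \<in> U \<Longrightarrow> (\<Sum>w\<in>{w\<in>U. R u w}. B u w) \<le> Br"
    and Bc: "\<And>w. w \<in> U \<Longrightarrow> (\<Sum>u\<in>{u\<in>U. R u w}. B u w) \<le> Bc"
    and pos: "0 < Ar" "0 < Ac" "0 < Br" "0 < Bc"
begin

text \<open>The \<ell>_1 estimate of a matrix by its column sums, by exchanging the order of
  summation.\<close>

lemma column_sum_bound:
  fixes X :: "'i \<Rightarrow> 'i \<Rightarrow> real"
  assumes c: "\<And>w. w \<in> U \<Longrightarrow> (\<Sum>u\<in>{u\<in>U. R u w}. X u w) \<le> C" and x: "\<And>w. w \<in> U \<Longrightarrow> 0 \<le> x w"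
  shows "(\<Sum>u\<in>U. \<Sum>w\<in>{w\<in>U. R u w}. X u w * x w) \<le> C * (\<Sum>w\<in>U. x w)"
proof -
  have "(\<Sum>u\<in>U. \<Sum>w\<in>{w\<in>U. R u w}. X u w * x w) = (\<Sum>w\<in>U. \<Sum>u\<in>{u\<in>U. R u w}. X u w * x w)"
    by (rule sum.swap_restrict[OF fin fin])
  also have "\<dots> = (\<Sum>w\<in>U. (\<Sum>u\<in>{u\<in>U. R u w}. X u w) * x w)"
    by (simp only: sum_distrib_right)
  also have "\<dots> \<le> (\<Sum>w\<in>U. C * x w)"
    by (intro sum_mono mult_right_mono c x)
  finally show ?thesis by (simp add: sum_distrib_left)
qed

text \<open>Hoelder along one row uses up the row sum of \<open>B\<close> and leaves the entries of
  \<open>A\<close> unsummed, so that these can still be summed over rows or over columns.\<close>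

lemma row_power_bound:
  assumes u: "u \<in> U" and a: "\<And>w. w \<in> U \<Longrightarrow> 0 \<le> a w" and r: "1 \<le> r"
  shows "(\<Sum>w\<in>{w\<in>U. R u w}. A u w powr (1/r) * B u w powr (1 - 1/r) * a w) powr r
    \<le> Br powr (r - 1) * (\<Sum>w\<in>{w\<in>U. R u w}. A u w * a w powr r)"
proof -
  let ?W = "{w\<in>U. R u w}"
  have "(\<Sum>w\<in>?W. A u w powr (1/r) * B u w powr (1 - 1/r) * a w)
      = (\<Sum>w\<in>?W. (A u w * a w powr r) powr (1/r) * B u w powr (1 - 1/r))"
    using r A u a by (intro sum.cong) (auto simp: powr_mult powr_powr less_imp_le)
  also have "\<dots> \<le> (\<Sum>w\<in>?W. A u w * a w powr r) powr (1/r) * (\<Sum>w\<in>?W. B u w) powr (1 - 1/r)"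
    using r u a A B fin by (intro sum_Holder) (auto simp: less_imp_le)
  also have "\<dots> \<le> (\<Sum>w\<in>?W. A u w * a w powr r) powr (1/r) * Br powr (1 - 1/r)"
    using r u B Br by (intro mult_left_mono powr_mono2 sum_nonneg) (auto intro!: less_imp_le)
  finally have "(\<Sum>w\<in>?W. A u w powr (1/r) * B u w powr (1 - 1/r) * a w) powr r
    \<le> ((\<Sum>w\<in>?W. A u w * a w powr r) powr (1/r) * Br powr (1 - 1/r)) powr r"
    using r a by (intro powr_mono2) (auto intro!: sum_nonneg)
  also have "\<dots> = Br powr (r - 1) * (\<Sum>w\<in>?W. A u w * a w powr r)"
  proof -
    have "0 \<le> (\<Sum>w\<in>?W. A u w * a w powr r)" using u A by (intro sum_nonneg mult_nonneg_nonneg) (auto intro: less_imp_le)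
    then show ?thesis using r pos by (simp add: powr_mult powr_powr left_diff_distrib)
  qed
  finally show ?thesis .
qed

text \<open>Interpolation by hand in three stages: Hoelder with exponent \<open>p\<close> produces
  the row sums \<open>Br\<close>, Jensen with exponent q/p produces the row sums \<open>Ar\<close>,
  and summation over \<open>u\<close> produces the column sums \<open>Ac\<close>. Some of the stages
  disappear when \<open>p\<close> or \<open>q\<close> is \<infinity>.\<close>

lemma lq_bound_le:
  assumes p: "1 \<le> p" and pq: "p \<le> q"
    and a: "\<And>w. w \<in> U \<Longrightarrow> 0 \<le> a w" and b0: "\<And>u. u \<in> U \<Longrightarrow> 0 \<le> b u"
    and b: "\<And>u. u \<in> U \<Longrightarrow> b u \<le> (\<Sum>w\<in>{w\<in>U. R u w}. A u w powr recip p * B u w powr (1 - recip p) * a w)"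
  shows "lq_norm q U b \<le> Ar powr (recip p - recip q) * Ac powr recip q * Br powr (1 - recip p) * lq_norm q U a"
proof (cases "p = \<infinity>")
  case True
  then have q: "q = \<infinity>" using pq by (simp add: top_unique)
  have "b u \<le> Br * Max (a ` U)" if u: "u \<in> U" for u
  proof -
    have "b u \<le> (\<Sum>w\<in>{w\<in>U. R u w}. B u w * a w)"
    proof -
      \<comment> \<open>For \<open>p = \<infinity>\<close> the factor of \<open>A\<close> is
        \<open>A u w powr 0\<close>, which is 1 only because the entry is positive.\<close>
      have "(\<Sum>w\<in>{w\<in>U. R u w}. A u w powr recip p * B u w powr (1 - recip p) * a w) = (\<Sum>w\<in>{w\<in>U. R u w}. B u w * a w)"
      proof (intro sum.cong refl)
        fix w assume "w \<in> {w\<in>U. R u w}"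
        then have "0 < A u w" "0 < B u w" using A[OF u] B[OF u] by auto
        then show "A u w powr recip p * B u w powr (1 - recip p) * a w = B u w * a w" by (simp add: True)
      qed
      with b[OF u] show ?thesis by simp
    qed
    also have "\<dots> \<le> (\<Sum>w\<in>{w\<in>U. R u w}. B u w * Max (a ` U))"
      using fin B[OF u] by (intro sum_mono mult_left_mono) (auto simp: less_imp_le)
    also have "\<dots> = (\<Sum>w\<in>{w\<in>U. R u w}. B u w) * Max (a ` U)" by (simp add: sum_distrib_right)
    also have "\<dots> \<le> Br * Max (a ` U)"
      using lq_norm_nonneg[OF fin ne a, where q=\<infinity>] by (intro mult_right_mono Br u) (simp_all add: lq_norm_def)
    finally show ?thesis .
  qed
  then show ?thesis
    using fin ne pos by (simp add: True q lq_norm_def)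
next
  case False
  with p obtain r where r: "1 \<le> r" "p = ennreal r" by (auto elim: ennreal_ge_1_cases)
  have br: "b u powr r \<le> Br powr (r - 1) * (\<Sum>w\<in>{w\<in>U. R u w}. A u w * a w powr r)" if u: "u \<in> U" for u
  proof -
    have "b u powr r \<le> (\<Sum>w\<in>{w\<in>U. R u w}. A u w powr (1/r) * B u w powr (1 - 1/r) * a w) powr r"
      using b[OF u] b0[OF u] r by (intro powr_mono2) (auto simp: recip_ennreal)
    also note row_power_bound[OF u a r(1)]
    finally show ?thesis .
  qed
  show ?thesis
  proof (cases "q = \<infinity>")
    case True
    let ?N = "Max (a ` U)"
    have N: "0 \<le> ?N"
      using lq_norm_nonneg[OF fin ne a, where q=\<infinity>] by (simp add: lq_norm_def)
    have "b u \<le> Ar powr (1/r) * Br powr (1 - 1/r) * ?N" if u: "u \<in> U" for u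
    proof -
      \<comment> \<open>For \<open>q = \<infinity>\<close> each row is estimated separately with
        \<open>a w\<close> replaced by its maximum, so only row sums occur.\<close>
      have "(\<Sum>w\<in>{w\<in>U. R u w}. A u w * a w powr r) \<le> (\<Sum>w\<in>{w\<in>U. R u w}. A u w * ?N powr r)"
        using fin r a A[OF u] by (intro sum_mono mult_left_mono powr_mono2) (auto simp: less_imp_le)
      also have "\<dots> = (\<Sum>w\<in>{w\<in>U. R u w}. A u w) * ?N powr r" by (simp add: sum_distrib_right)
      also have "\<dots> \<le> Ar * ?N powr r" by (intro mult_right_mono Ar u) simp
      finally have "b u powr r \<le> Br powr (r - 1) * (Ar * ?N powr r)"
        using br[OF u] by (meson mult_left_mono order_trans powr_ge_zero)
      then have "(b u powr r) powr (1/r) \<le> (Br powr (r - 1) * (Ar * ?N powr r)) powr (1/r)"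
        using r by (intro powr_mono2) auto
      then show ?thesis
        using r b0[OF u] N pos by (simp add: powr_mult powr_powr diff_divide_distrib mult_ac)
    qed
    then show ?thesis
      using fin ne pos r by (simp add: True lq_norm_def recip_ennreal)
  next
    case False
    have "1 \<le> q" using p pq by simp
    with False obtain s where s: "1 \<le> s" "q = ennreal s" by (auto elim: ennreal_ge_1_cases)
    then have rs: "r \<le> s" using r pq by simp
    \<comment> \<open>This is where p \<le> q enters: s/r is the exponent of the second, convex step
      that raises the \<open>r\<close>-th powers to \<open>s\<close>-th powers.\<close>
    have sr: "1 \<le> s / r" using rs r by simp
    have bs: "b u powr s \<le> Br powr ((r - 1) * (s/r)) * (Ar powr (s/r - 1) * (\<Sum>w\<in>{w\<in>U. R u w}. A u w * a w powr s))"
      if u: "u \<in> U" for u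
    proof -
      have "b u powr s = (b u powr r) powr (s/r)" using r b0[OF u] by (simp add: powr_powr)
      also have "\<dots> \<le> (Br powr (r - 1) * (\<Sum>w\<in>{w\<in>U. R u w}. A u w * a w powr r)) powr (s/r)"
        using r sr by (intro powr_mono2 br u) auto
      also have "\<dots> = Br powr ((r - 1) * (s/r)) * (\<Sum>w\<in>{w\<in>U. R u w}. A u w * a w powr r) powr (s/r)"
        using A[OF u] pos by (simp add: powr_mult powr_powr sum_nonneg less_imp_le)
      also have "(\<Sum>w\<in>{w\<in>U. R u w}. A u w * a w powr r) powr (s/r)
          \<le> (\<Sum>w\<in>{w\<in>U. R u w}. A u w) powr (s/r - 1) * (\<Sum>w\<in>{w\<in>U. R u w}. A u w * (a w powr r) powr (s/r))"
        using fin A[OF u] sr by (intro powr_sum_weighted_le) (auto simp: less_imp_le)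
      also have "\<dots> \<le> Ar powr (s/r - 1) * (\<Sum>w\<in>{w\<in>U. R u w}. A u w * (a w powr r) powr (s/r))"
        using A[OF u] sr by (intro mult_right_mono powr_mono2 Ar u) (auto intro!: sum_nonneg simp: less_imp_le)
      also have "(\<Sum>w\<in>{w\<in>U. R u w}. A u w * (a w powr r) powr (s/r)) = (\<Sum>w\<in>{w\<in>U. R u w}. A u w * a w powr s)"
        using r by (simp add: powr_powr)
      finally show ?thesis by (simp add: mult_left_mono)
    qed
    let ?K = "Ar powr (1/r - 1/s) * Ac powr (1/s) * Br powr (1 - 1/r)"
    have "(\<Sum>u\<in>U. b u powr s)
        \<le> (\<Sum>u\<in>U. Br powr ((r - 1) * (s/r)) * (Ar powr (s/r - 1) * (\<Sum>w\<in>{w\<in>U. R u w}. A u w * a w powr s)))"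
      by (intro sum_mono bs)
    also have "\<dots> = Br powr ((r - 1) * (s/r)) * Ar powr (s/r - 1) * (\<Sum>u\<in>U. \<Sum>w\<in>{w\<in>U. R u w}. A u w * a w powr s)"
      by (simp add: mult.assoc flip: sum_distrib_left)
    also have "\<dots> \<le> Br powr ((r - 1) * (s/r)) * Ar powr (s/r - 1) * (Ac * (\<Sum>w\<in>U. a w powr s))"
      by (intro mult_left_mono column_sum_bound Ac) auto
    also have "\<dots> = ?K powr s * (\<Sum>w\<in>U. a w powr s)"
    proof -
      have "?K powr s = Ar powr ((1/r - 1/s) * s) * Ac powr (1/s * s) * Br powr ((1 - 1/r) * s)"
        using pos by (simp add: powr_mult powr_powr)
      moreover have "(1/r - 1/s) * s = s/r - 1" "1/s * s = 1" "(1 - 1/r) * s = (r - 1) * (s/r)"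
        using r s by (simp_all add: field_simps)
      ultimately show ?thesis using pos by (simp only: powr_one mult_ac)
    qed
    finally have "lq_norm (ennreal s) U b \<le> ?K * lq_norm (ennreal s) U a"
      using s a by (intro lq_norm_leI) auto
    then show ?thesis using r s by (simp add: recip_ennreal)
  qed
qed

text \<open>Now Hoelder is applied with the smaller exponent q = s. The factor
  \<open>B u w powr (1 - 1/s)\<close> is split off for the row sums, and the remaining matrix
  \<open>X\<close> is again a geometric mean of \<open>A\<close> and \<open>B\<close>, whose column
  sums are estimated by a second Hoelder inequality.\<close>

lemma lq_bound_ge:
  assumes q: "1 \<le> q" and qp: "q \<le> p"
    and a: "\<And>w. w \<in> U \<Longrightarrow> 0 \<le> a w" and b0: "\<And>u. u \<in> U \<Longrightarrow> 0 \<le> b u"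
    and b: "\<And>u. u \<in> U \<Longrightarrow> b u \<le> (\<Sum>w\<in>{w\<in>U. R u w}. A u w powr recip p * B u w powr (1 - recip p) * a w)"
  shows "lq_norm q U b \<le> Bc powr (recip q - recip p) * Ac powr recip p * Br powr (1 - recip q) * lq_norm q U a"
proof (cases "q = \<infinity>")
  case True
  then have "p = \<infinity>" using qp by (simp add: top_unique)
  with True show ?thesis
    using lq_bound_le[of p q a b] a b0 b pos by simp
next
  case False
  with q obtain s where s: "1 \<le> s" "q = ennreal s" by (auto elim: ennreal_ge_1_cases)
  define \<theta> where "\<theta> = recip p"
  have "1 \<le> p" using q qp by simp
  then have \<theta>0: "0 \<le> \<theta>" by (simp add: \<theta>_def recip_bounds)
  \<comment> \<open>This is where q \<le> p enters: it makes the exponents of \<open>X\<close> lie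
    between 0 and 1.\<close>
  have s\<theta>: "s * \<theta> \<le> 1"
    using \<open>1 \<le> p\<close>
  proof (cases rule: ennreal_ge_1_cases)
    case (2 r)
    then show ?thesis using s qp by (simp add: \<theta>_def recip_ennreal)
  qed (simp add: \<theta>_def)
  \<comment> \<open>Chosen so that \<open>X u w powr (1/s) * B u w powr (1 - 1/s)\<close> equals
    \<open>A u w powr \<theta> * B u w powr (1 - \<theta>)\<close>.\<close>
  define X where "X u w = A u w powr (s * \<theta>) * B u w powr (1 - s * \<theta>)" for u w
  have bs: "b u powr s \<le> Br powr (s - 1) * (\<Sum>w\<in>{w\<in>U. R u w}. X u w * a w powr s)" if u: "u \<in> U" for u
  proof -
    let ?W = "{w\<in>U. R u w}"
    have "A u w powr \<theta> * B u w powr (1 - \<theta>) * a w = (X u w * a w powr s) powr (1/s) * B u w powr (1 - 1/s)"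
      if w: "w \<in> ?W" for w
    proof -
      have "(X u w * a w powr s) powr (1/s) * B u w powr (1 - 1/s)
        = A u w powr (s * \<theta> * (1/s)) * (B u w powr ((1 - s * \<theta>) * (1/s)) * B u w powr (1 - 1/s)) * a w"
        using s w a by (simp add: X_def powr_mult powr_powr)
      also have "B u w powr ((1 - s * \<theta>) * (1/s)) * B u w powr (1 - 1/s) = B u w powr (1 - \<theta>)"
      proof -
        have "(1 - s * \<theta>) * (1/s) + (1 - 1/s) = 1 - \<theta>" using s by (simp add: field_simps)
        then show ?thesis by (simp only: powr_add[symmetric])
      qed
      finally show ?thesis using s by simp
    qed
    then have "b u \<le> (\<Sum>w\<in>?W. (X u w * a w powr s) powr (1/s) * B u w powr (1 - 1/s))"
      using b[OF u] by (simp add: \<theta>_def)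
    also have "\<dots> \<le> (\<Sum>w\<in>?W. X u w * a w powr s) powr (1/s) * (\<Sum>w\<in>?W. B u w) powr (1 - 1/s)"
      using s u B fin by (intro sum_Holder) (auto simp: less_imp_le X_def)
    also have "\<dots> \<le> (\<Sum>w\<in>?W. X u w * a w powr s) powr (1/s) * Br powr (1 - 1/s)"
      using s u B Br by (intro mult_left_mono powr_mono2 sum_nonneg) (auto intro!: less_imp_le)
    finally have "b u powr s \<le> ((\<Sum>w\<in>?W. X u w * a w powr s) powr (1/s) * Br powr (1 - 1/s)) powr s"
      using s b0[OF u] by (intro powr_mono2) auto
    also have "\<dots> = Br powr (s - 1) * (\<Sum>w\<in>?W. X u w * a w powr s)"
    proof -
      have "0 \<le> (\<Sum>w\<in>?W. X u w * a w powr s)" by (intro sum_nonneg) (auto simp: X_def)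
      then show ?thesis using s pos by (simp add: powr_mult powr_powr left_diff_distrib)
    qed
    finally show ?thesis .
  qed
  let ?K = "Bc powr (1/s - \<theta>) * Ac powr \<theta> * Br powr (1 - 1/s)"
  have "(\<Sum>u\<in>U. b u powr s) \<le> (\<Sum>u\<in>U. Br powr (s - 1) * (\<Sum>w\<in>{w\<in>U. R u w}. X u w * a w powr s))"
    by (intro sum_mono bs)
  also have "\<dots> = Br powr (s - 1) * (\<Sum>u\<in>U. \<Sum>w\<in>{w\<in>U. R u w}. X u w * a w powr s)"
    by (simp flip: sum_distrib_left)
  also have "\<dots> \<le> Br powr (s - 1) * (Ac powr (s * \<theta>) * Bc powr (1 - s * \<theta>) * (\<Sum>w\<in>U. a w powr s))"
  proof (intro mult_left_mono column_sum_bound)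
    fix w assume w: "w \<in> U"
    have "(\<Sum>u\<in>{u\<in>U. R u w}. X u w)
        \<le> (\<Sum>u\<in>{u\<in>U. R u w}. A u w) powr (s * \<theta>) * (\<Sum>u\<in>{u\<in>U. R u w}. B u w) powr (1 - s * \<theta>)"
      unfolding X_def using fin w A B s \<theta>0 s\<theta> by (intro sum_Holder) (auto simp: less_imp_le)
    also have "\<dots> \<le> Ac powr (s * \<theta>) * Bc powr (1 - s * \<theta>)"
      using A B w s \<theta>0 s\<theta>
      by (intro mult_mono powr_mono2 Ac Bc) (auto intro!: sum_nonneg simp: less_imp_le)
    finally show "(\<Sum>u\<in>{u\<in>U. R u w}. X u w) \<le> Ac powr (s * \<theta>) * Bc powr (1 - s * \<theta>)" .
  qed auto
  also have "\<dots> = ?K powr s * (\<Sum>w\<in>U. a w powr s)"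
  proof -
    have "?K powr s = Bc powr ((1/s - \<theta>) * s) * Ac powr (\<theta> * s) * Br powr ((1 - 1/s) * s)"
      using pos by (simp add: powr_mult powr_powr)
    moreover have "(1/s - \<theta>) * s = 1 - s * \<theta>" "(1 - 1/s) * s = s - 1"
      using s by (simp_all add: field_simps)
    ultimately show ?thesis by (simp add: mult_ac)
  qed
  finally have "lq_norm (ennreal s) U b \<le> ?K * lq_norm (ennreal s) U a"
    using s a by (intro lq_norm_leI) auto
  then show ?thesis using s by (simp add: recip_ennreal \<theta>_def)
qed

end

section \<open>Integrating out variables in product spaces\<close>

text \<open>Jensen for a weight \<open>h\<close> of arbitrary finite mass, by integrating the
  tangent inequality at the \<open>h\<close>-mean of |f|. Integrability of \<open>f * h\<close> is
  not assumed: without it the integral on the left is 0, and the claim is trivial.\<close>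

lemma Jensen_weighted:
  fixes f :: "'a \<Rightarrow> complex"
  assumes [measurable]: "f \<in> borel_measurable N" and h: "integrable N h" "\<And>y. y \<in> space N \<Longrightarrow> 0 \<le> h y"
    and r: "1 \<le> r"
  shows "ennreal (norm (LINT y|N. f y * of_real (h y)) powr r)
    \<le> ennreal ((LINT y|N. h y) powr (r - 1)) * (\<integral>\<^sup>+y. ennreal (h y * norm (f y) powr r) \<partial>N)"
proof -
  let ?c = "LINT y|N. h y" and ?Z = "LINT y|N. f y * of_real (h y)" and ?I = "LINT y|N. norm (f y) * h y"
  have [measurable]: "h \<in> borel_measurable N" using h by auto
  have ae: "AE y in N. 0 \<le> h y" using h by (intro AE_I2)
  have c0: "0 \<le> ?c" using ae by (rule integral_nonneg_AE)
  show ?thesis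
  proof (cases "?Z = 0")
    case False
    then have int: "integrable N (\<lambda>y. f y * of_real (h y))"
      using not_integrable_integral_eq by blast
    have "?c \<noteq> 0"
    proof
      assume "?c = 0"
      then have "AE y in N. h y = 0"
        using integral_nonneg_eq_0_iff_AE[OF h(1) ae] by simp
      then have "?Z = 0"
        by (intro integral_eq_zero_AE) auto
      with False show False ..
    qed
    with c0 have c: "0 < ?c" by simp
    have int': "integrable N (\<lambda>y. norm (f y) * h y)"
      using integrable_norm[OF int] by (rule integrable_cong_AE_imp) (use ae in \<open>auto simp: norm_mult\<close>)
    have ZI: "norm ?Z \<le> ?I"
    proof -
      have "norm ?Z \<le> (LINT y|N. norm (f y * of_real (h y)))" by (rule integral_norm_bound)
      also have "\<dots> = ?I" by (intro integral_cong_AE) (use ae in \<open>auto simp: norm_mult\<close>)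
      finally show ?thesis .
    qed
    with False have I: "0 < ?I" by (meson less_le_trans zero_less_norm_iff)
    show ?thesis
    proof (cases "(\<integral>\<^sup>+y. ennreal (h y * norm (f y) powr r) \<partial>N) = \<infinity>")
      case True
      then show ?thesis using c by (simp add: ennreal_mult_top)
    next
      case False
      have intr: "integrable N (\<lambda>y. h y * norm (f y) powr r)"
        using False ae by (intro integrableI_nonneg) (auto simp: less_top)
      \<comment> \<open>The \<open>h\<close>-mean of |f|. With this tangent point the linear term of
        the integrated tangent inequality vanishes.\<close>
      define t where "t = ?I / ?c"
      have t: "0 < t" using I c by (simp add: t_def)
      have "?I powr r = ?c powr (r - 1) * (t powr r * ?c)"
        using I c by (simp add: t_def powr_divide mult_ac flip: powr_minus_1_mult[of ?c r])
      also have "t powr r * ?c = (LINT y|N. t powr r * h y + r * t powr (r - 1) * (norm (f y) * h y - t * h y))"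
        using int' h c by (simp add: t_def)
      also have "\<dots> \<le> (LINT y|N. h y * norm (f y) powr r)"
      proof (intro integral_mono)
        fix y assume "y \<in> space N"
        then have "(t powr r + r * t powr (r - 1) * (norm (f y) - t)) * h y \<le> norm (f y) powr r * h y"
          using t r h(2) by (intro mult_right_mono powr_tangent_le) auto
        then show "t powr r * h y + r * t powr (r - 1) * (norm (f y) * h y - t * h y) \<le> h y * norm (f y) powr r"
          by (simp add: algebra_simps)
      qed (use int' h intr in auto)
      finally have "?I powr r \<le> ?c powr (r - 1) * (LINT y|N. h y * norm (f y) powr r)"
        by (simp add: mult_left_mono)
      moreover have "norm ?Z powr r \<le> ?I powr r" using ZI r by (intro powr_mono2) auto
      ultimately have "ennreal (norm ?Z powr r) \<le> ennreal (?c powr (r - 1) * (LINT y|N. h y * norm (f y) powr r))"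
        by (intro ennreal_leI) linarith
      also have "\<dots> = ennreal (?c powr (r - 1)) * (\<integral>\<^sup>+y. ennreal (h y * norm (f y) powr r) \<partial>N)"
      proof -
        have ae': "AE y in N. 0 \<le> h y * norm (f y) powr r" using ae by eventually_elim simp
        show ?thesis
          using nn_integral_eq_integral[OF intr ae'] integral_nonneg_AE[OF ae'] by (simp add: ennreal_mult)
      qed
      finally show ?thesis .
    qed
  qed simp
qed

section \<open>Null sets in finite products\<close>

lemma (in product_sigma_finite) AE_PiM_finite_component:
  assumes I: "finite I" "i \<in> I" and ae: "AE x in M i. P x"
  shows "AE x in PiM I M. P (x i)"
proof -
  obtain N where N: "N \<in> sets (M i)" "emeasure (M i) N = 0" "{x \<in> space (M i). \<not> P x} \<subseteq> N"
    using ae by (auto elim: AE_E)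
  let ?A = "\<lambda>j. if j = i then N else space (M j)"
  have "emeasure (PiM I M) (Pi\<^sub>E I ?A) = (\<Prod>j\<in>I. emeasure (M j) (?A j))"
    using N by (intro emeasure_PiM I) auto
  \<comment> \<open>The other factors may have infinite measure, as for the half-line; the product
    is still 0, because 0 times \<infinity> is 0 in \<open>ennreal\<close>.\<close>
  also have "\<dots> = 0" using I N by (auto intro!: prod_zero)
  finally have "Pi\<^sub>E I ?A \<in> null_sets (PiM I M)"
    using N I by (auto intro!: null_setsI sets_PiM_I_finite)
  moreover have "{x \<in> space (PiM I M). \<not> P (x i)} \<subseteq> Pi\<^sub>E I ?A"
    using N(3) I by (auto simp: space_PiM PiE_iff extensional_def)
  ultimately show ?thesis by (rule AE_I')
qed

lemma (in product_sigma_finite) AE_PiM_finite_components: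
  assumes "finite I" and "\<And>i. i \<in> I \<Longrightarrow> AE x in M i. P i x"
  shows "AE x in PiM I M. \<forall>i\<in>I. P i (x i)"
  using assms by (simp add: AE_ball_countable countable_finite AE_PiM_finite_component)

text \<open>Fubini for null sets: the measure on the joint index set is the image of the binary
  product under \<open>merge\<close>.\<close>

lemma (in product_sigma_finite) AE_PiM_merge:
  assumes IJ: "I \<inter> J = {}" "finite I" "finite J" and ae: "AE z in PiM (I \<union> J) M. P z"
  shows "AE x in PiM I M. AE y in PiM J M. P (merge I J (x, y))"
proof -
  interpret I: finite_product_sigma_finite M I by standard fact
  interpret J: finite_product_sigma_finite M J by standard fact
  interpret pair_sigma_finite "PiM I M" "PiM J M" ..
  from ae have "AE z in distr (PiM I M \<Otimes>\<^sub>M PiM J M) (PiM (I \<union> J) M) (merge I J). P z"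
    by (simp only: distr_merge[OF IJ])
  then have "AE z in PiM I M \<Otimes>\<^sub>M PiM J M. P (merge I J z)"
    by (rule AE_distrD[OF measurable_merge])
  then show ?thesis by (rule AE_pair)
qed

lemma prod_merge:
  assumes "I \<inter> J = {}" "finite I" "finite J"
  shows "(\<Prod>j\<in>I \<union> J. f j (merge I J (x, y) j)) = (\<Prod>j\<in>I. f j (x j)) * (\<Prod>j\<in>J. f j (y j))"
proof -
  have "(\<Prod>j\<in>I. f j (merge I J (x, y) j)) = (\<Prod>j\<in>I. f j (x j))"
    using assms by (intro prod.cong) auto
  moreover have "(\<Prod>j\<in>J. f j (merge I J (x, y) j)) = (\<Prod>j\<in>J. f j (y j))"
    using assms by (intro prod.cong) auto
  ultimately show ?thesis using assms by (simp add: prod.union_disjoint)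
qed

section \<open>Integrating out variables against a weight \<eta> (later \<open>psi_bar\<close>)
  dominated by the density\<close>

locale density_pair = sigma_finite_measure M for M :: "'a measure" +
  fixes \<psi> \<eta> :: "'a \<Rightarrow> real" and \<kappa> :: real
  assumes psi_meas [measurable]: "\<psi> \<in> borel_measurable M"
    and eta_meas [measurable]: "\<eta> \<in> borel_measurable M"
    and psi_ge0: "\<And>t. t \<in> space M \<Longrightarrow> 0 \<le> \<psi> t"
    and psi_gt0: "AE t in M. 0 < \<psi> t"
    and psi_nn_integral: "(\<integral>\<^sup>+t. ennreal (\<psi> t) \<partial>M) = 1"
    and eta_ge0: "\<And>t. 0 \<le> \<eta> t"
    and kappa_gt0: "0 < \<kappa>"
    and eta_le: "AE t in M. \<eta> t \<le> \<kappa> * \<psi> t"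
begin

sublocale product_sigma_finite "\<lambda>_::nat. M"
  by unfold_locales

abbreviation PM :: "nat set \<Rightarrow> (nat \<Rightarrow> 'a) measure" where
  "PM u \<equiv> Pi\<^sub>M u (\<lambda>_. M)"

definition WM :: "ennreal \<Rightarrow> nat set \<Rightarrow> (nat \<Rightarrow> 'a) measure" where
  "WM p u = (if p = \<infinity> then PM u else density (PM u) (\<lambda>t. ennreal (\<Prod>j\<in>u. \<psi> (t j))))"

text \<open>The integral is \<open>0\<close> at points whose slice is not integrable; for \<open>g\<close> in \<open>L\<^sub>p\<close> these form a null
  set.\<close>

definition marg :: "nat set \<Rightarrow> nat set \<Rightarrow> ((nat \<Rightarrow> 'a) \<Rightarrow> complex) \<Rightarrow> (nat \<Rightarrow> 'a) \<Rightarrow> complex" where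
  "marg u v g x = (LINT y|PM v. g (merge u v (x, y)) * of_real (\<Prod>j\<in>v. \<eta> (y j)))"

abbreviation m :: real where "m \<equiv> LINT t|M. \<eta> t"

lemma WM_top: "WM \<infinity> u = PM u"
  by (simp add: WM_def)

lemma sets_WM [simp]: "sets (WM p u) = sets (PM u)"
  by (simp add: WM_def)

lemma measurable_WM [simp]: "borel_measurable (WM p u) = borel_measurable (PM u)"
  by (intro measurable_cong_sets) auto

lemma psi_int: "integrable M \<psi>"
  using psi_nn_integral psi_ge0 by (intro integrableI_nonneg) (auto intro: AE_I2)

lemma eta_int: "integrable M \<eta>"
  by (rule Bochner_Integration.integrable_bound[where f="\<lambda>t. \<kappa> * \<psi> t"])
    (use eta_le psi_int in \<open>auto simp: eta_ge0 elim!: eventually_mono\<close>)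

lemma kappa_ge0: "0 \<le> \<kappa>"
  using kappa_gt0 by simp

lemma m_ge0: "0 \<le> m"
  by (simp add: eta_ge0)

lemma prod_psi_int: "finite u \<Longrightarrow> integrable (PM u) (\<lambda>t. \<Prod>j\<in>u. \<psi> (t j))"
  by (intro product_integrable_prod psi_int)

lemma prod_eta_int: "finite u \<Longrightarrow> integrable (PM u) (\<lambda>t. \<Prod>j\<in>u. \<eta> (t j))"
  by (intro product_integrable_prod eta_int)

lemma integral_prod_eta: "finite u \<Longrightarrow> (LINT t|PM u. (\<Prod>j\<in>u. \<eta> (t j))) = m ^ card u"
  by (subst product_integral_prod) (auto simp: eta_int)

lemma prod_psi_ge0: "t \<in> space (PM u) \<Longrightarrow> 0 \<le> (\<Prod>j\<in>u. \<psi> (t j))"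
  by (intro prod_nonneg) (auto simp: space_PiM PiE_iff psi_ge0)

lemma prod_psi_gt0: "finite u \<Longrightarrow> AE t in PM u. 0 < (\<Prod>j\<in>u. \<psi> (t j))"
  using AE_PiM_finite_components[of u "\<lambda>_ t. 0 < \<psi> t"] psi_gt0
  by (auto elim!: eventually_mono intro: prod_pos)

text \<open>The density is positive almost everywhere, so weighted and unweighted null sets
  coincide. Hence the unweighted essential supremum used for \<open>p = \<infinity>\<close> is
  compatible with the weighted norms.\<close>

lemma AE_WM_iff: "finite u \<Longrightarrow> (AE t in WM p u. P t) \<longleftrightarrow> (AE t in PM u. P t)"
proof (cases "p = \<infinity>")
  case False
  assume u: "finite u"
  have "(AE t in WM p u. P t) \<longleftrightarrow> (AE t in PM u. 0 < ennreal (\<Prod>j\<in>u. \<psi> (t j)) \<longrightarrow> P t)"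
    using False unfolding WM_def by (simp add: AE_density)
  also have "\<dots> \<longleftrightarrow> (AE t in PM u. P t)"
    using prod_psi_gt0[OF u] by (auto elim: eventually_elim2)
  finally show ?thesis .
next
  case True
  then show ?thesis by (simp only: WM_top)
qed

lemma prod_kernel_bound:
  assumes u: "finite u" and k: "\<And>j. j \<in> u \<Longrightarrow> AE t in M. \<bar>k j t\<bar> \<le> C j * \<psi> t"
  shows "AE t in PM u. \<bar>\<Prod>j\<in>u. k j (t j)\<bar> \<le> (\<Prod>j\<in>u. C j) * (\<Prod>j\<in>u. \<psi> (t j))"
  using AE_PiM_finite_components[OF u, of "\<lambda>j t. \<bar>k j t\<bar> \<le> C j * \<psi> t"] k
  by (auto elim!: eventually_mono simp: abs_prod simp flip: prod.distrib intro!: prod_mono)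

lemma prod_eta_le:
  assumes u: "finite u"
  shows "AE t in PM u. (\<Prod>j\<in>u. \<eta> (t j)) \<le> \<kappa> ^ card u * (\<Prod>j\<in>u. \<psi> (t j))"
  using prod_kernel_bound[OF u, of "\<lambda>_. \<eta>" "\<lambda>_. \<kappa>"] eta_le
  by (simp add: eta_ge0 abs_prod)

lemma marg_measurable:
  assumes "finite u" "finite v" and g: "g \<in> borel_measurable (PM (u \<union> v))"
  shows "marg u v g \<in> borel_measurable (PM u)"
proof -
  interpret V: finite_product_sigma_finite "\<lambda>_. M" v by standard fact
  note [measurable] = g
  have "(\<lambda>z. g (merge u v z)) \<in> borel_measurable (PM u \<Otimes>\<^sub>M PM v)"
    by (rule measurable_compose[OF measurable_merge g])
  then have [measurable]: "(\<lambda>z. g (merge u v (fst z, snd z))) \<in> borel_measurable (PM u \<Otimes>\<^sub>M PM v)"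
    by simp
  have "(\<lambda>x. LINT y|PM v. g (merge u v (x, y)) * of_real (\<Prod>j\<in>v. \<eta> (y j))) \<in> borel_measurable (PM u)"
    by (intro V.borel_measurable_lebesgue_integral) (simp add: split_beta')
  then show ?thesis by (simp add: marg_def[abs_def])
qed

lemma marg_slice_measurable:
  assumes x: "x \<in> space (PM u)" and g: "g \<in> borel_measurable (PM (u \<union> v))"
  shows "(\<lambda>y. g (merge u v (x, y))) \<in> borel_measurable (PM v)"
  by (rule measurable_compose[OF measurable_compose[OF measurable_Pair1'[OF x] measurable_merge] g])

text \<open>Jensen on each slice, for the weight \<eta> of total mass \<open>m ^ card v\<close>,
  gives the power of \<open>m\<close>. Then \<eta> \<le> \<kappa>\<psi> replaces that weight by
  \<psi>, at the cost of \<open>\<kappa> ^ card v\<close>, and Tonelli joins it with the density in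
  the variables of \<open>u\<close> to the density on the union.\<close>

lemma marg_Lp_finite:
  assumes uv: "u \<inter> v = {}" "finite u" "finite v" and r: "1 \<le> r"
    and g: "g \<in> borel_measurable (PM (u \<union> v))"
  shows "(\<integral>\<^sup>+x. ennreal (norm (marg u v g x) powr r) \<partial>WM (ennreal r) u)
    \<le> ennreal ((m ^ card v) powr (r - 1) * \<kappa> ^ card v) * (\<integral>\<^sup>+z. ennreal (norm (g z) powr r) \<partial>WM (ennreal r) (u \<union> v))"
proof -
  note [measurable] = g marg_measurable[OF uv(2,3) g]
  let ?c = "(m ^ card v) powr (r - 1)"
  let ?h = "\<lambda>z. ennreal (\<Prod>j\<in>u \<union> v. \<psi> (z j)) * ennreal (norm (g z) powr r)"
  have slice: "ennreal (\<Prod>j\<in>u. \<psi> (x j)) * ennreal (norm (marg u v g x) powr r)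
      \<le> ennreal (?c * \<kappa> ^ card v) * (\<integral>\<^sup>+y. ?h (merge u v (x, y)) \<partial>PM v)" if x: "x \<in> space (PM u)" for x
  proof -
    note [measurable] = marg_slice_measurable[OF x g]
    have "ennreal (norm (marg u v g x) powr r)
        \<le> ennreal ?c * (\<integral>\<^sup>+y. ennreal ((\<Prod>j\<in>v. \<eta> (y j)) * norm (g (merge u v (x, y))) powr r) \<partial>PM v)"
      unfolding marg_def integral_prod_eta[OF uv(3), symmetric]
      by (intro Jensen_weighted r prod_eta_int uv prod_nonneg) (auto simp: eta_ge0)
    also have "\<dots> \<le> ennreal ?c *
        (\<integral>\<^sup>+y. ennreal (\<kappa> ^ card v) * (ennreal (\<Prod>j\<in>v. \<psi> (y j)) * ennreal (norm (g (merge u v (x, y))) powr r)) \<partial>PM v)"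
    proof (intro mult_left_mono nn_integral_mono_AE)
      show "AE y in PM v. ennreal ((\<Prod>j\<in>v. \<eta> (y j)) * norm (g (merge u v (x, y))) powr r)
        \<le> ennreal (\<kappa> ^ card v) * (ennreal (\<Prod>j\<in>v. \<psi> (y j)) * ennreal (norm (g (merge u v (x, y))) powr r))"
        using prod_eta_le[OF uv(3)]
      proof (rule AE_mp, intro AE_I2 impI)
        fix y assume y: "y \<in> space (PM v)" and "(\<Prod>j\<in>v. \<eta> (y j)) \<le> \<kappa> ^ card v * (\<Prod>j\<in>v. \<psi> (y j))"
        then have "(\<Prod>j\<in>v. \<eta> (y j)) * norm (g (merge u v (x, y))) powr r
            \<le> \<kappa> ^ card v * (\<Prod>j\<in>v. \<psi> (y j)) * norm (g (merge u v (x, y))) powr r"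
          by (intro mult_right_mono) auto
        from ennreal_leI[OF this] show "ennreal ((\<Prod>j\<in>v. \<eta> (y j)) * norm (g (merge u v (x, y))) powr r)
          \<le> ennreal (\<kappa> ^ card v) * (ennreal (\<Prod>j\<in>v. \<psi> (y j)) * ennreal (norm (g (merge u v (x, y))) powr r))"
          using prod_psi_ge0[OF y] kappa_ge0 by (simp add: ennreal_mult mult.assoc)
      qed
    qed auto
    also have "\<dots> = ennreal (?c * \<kappa> ^ card v) *
        (\<integral>\<^sup>+y. ennreal (\<Prod>j\<in>v. \<psi> (y j)) * ennreal (norm (g (merge u v (x, y))) powr r) \<partial>PM v)"
      using kappa_ge0 by (simp add: nn_integral_cmult ennreal_mult mult.assoc)
    finally have "ennreal (\<Prod>j\<in>u. \<psi> (x j)) * ennreal (norm (marg u v g x) powr r)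
      \<le> ennreal (\<Prod>j\<in>u. \<psi> (x j)) * (ennreal (?c * \<kappa> ^ card v) *
        (\<integral>\<^sup>+y. ennreal (\<Prod>j\<in>v. \<psi> (y j)) * ennreal (norm (g (merge u v (x, y))) powr r) \<partial>PM v))"
      by (intro mult_left_mono) auto
    also have "\<dots> = ennreal (?c * \<kappa> ^ card v) *
        (\<integral>\<^sup>+y. ennreal (\<Prod>j\<in>u. \<psi> (x j)) * (ennreal (\<Prod>j\<in>v. \<psi> (y j)) * ennreal (norm (g (merge u v (x, y))) powr r)) \<partial>PM v)"
    proof -
      have *: "(\<lambda>y. ennreal (\<Prod>j\<in>v. \<psi> (y j)) * ennreal (norm (g (merge u v (x, y))) powr r)) \<in> borel_measurable (PM v)"
        by measurable
      show ?thesis by (subst nn_integral_cmult[OF *]) (rule mult.left_commute)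
    qed
    also have "(\<integral>\<^sup>+y. ennreal (\<Prod>j\<in>u. \<psi> (x j)) * (ennreal (\<Prod>j\<in>v. \<psi> (y j)) * ennreal (norm (g (merge u v (x, y))) powr r)) \<partial>PM v)
      = (\<integral>\<^sup>+y. ?h (merge u v (x, y)) \<partial>PM v)"
      by (intro nn_integral_cong)
        (simp add: prod_merge[OF uv, of "\<lambda>_. \<psi>"] ennreal_mult prod_psi_ge0 x mult.assoc)
    finally show ?thesis .
  qed
  have "(\<integral>\<^sup>+x. ennreal (norm (marg u v g x) powr r) \<partial>WM (ennreal r) u)
      = (\<integral>\<^sup>+x. ennreal (\<Prod>j\<in>u. \<psi> (x j)) * ennreal (norm (marg u v g x) powr r) \<partial>PM u)"
    unfolding WM_def by (simp add: nn_integral_density)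
  also have "\<dots> \<le> (\<integral>\<^sup>+x. ennreal (?c * \<kappa> ^ card v) * (\<integral>\<^sup>+y. ?h (merge u v (x, y)) \<partial>PM v) \<partial>PM u)"
    by (intro nn_integral_mono slice)
  also have "\<dots> = ennreal (?c * \<kappa> ^ card v) * (\<integral>\<^sup>+x. \<integral>\<^sup>+y. ?h (merge u v (x, y)) \<partial>PM v \<partial>PM u)"
  proof (intro nn_integral_cmult)
    interpret V: finite_product_sigma_finite "\<lambda>_. M" v by standard fact
    have h: "?h \<in> borel_measurable (PM (u \<union> v))" by measurable
    show "(\<lambda>x. \<integral>\<^sup>+y. ?h (merge u v (x, y)) \<partial>PM v) \<in> borel_measurable (PM u)"
      using V.borel_measurable_nn_integral_fst[OF measurable_compose[OF measurable_merge h]] .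
  qed
  also have "(\<integral>\<^sup>+x. \<integral>\<^sup>+y. ?h (merge u v (x, y)) \<partial>PM v \<partial>PM u) = (\<integral>\<^sup>+z. ?h z \<partial>PM (u \<union> v))"
    by (intro product_nn_integral_fold[symmetric] uv) measurable
  also have "\<dots> = (\<integral>\<^sup>+z. ennreal (norm (g z) powr r) \<partial>WM (ennreal r) (u \<union> v))"
    unfolding WM_def by (simp add: nn_integral_density)
  finally show ?thesis .
qed

text \<open>For finite \<open>p\<close> this is the \<open>p\<close>-th root of the preceding
  estimate; for \<open>p = \<infinity>\<close> a slice bounded by \<open>B\<close> has integral at
  most \<open>m ^ card v * B\<close>. Keeping the powers of \<kappa> and \<open>m\<close> separate
  is what later lets the two matrices be summed separately.\<close>

lemma marg_Lp:
  assumes uv: "u \<inter> v = {}" "finite u" "finite v" and p: "1 \<le> p"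
    and g: "g \<in> Lp_space (WM p (u \<union> v)) p"
  shows "marg u v g \<in> Lp_space (WM p u) p \<and>
    Lp_norm (WM p u) p (marg u v g)
      \<le> (\<kappa> ^ card v) powr recip p * (m ^ card v) powr (1 - recip p) * Lp_norm (WM p (u \<union> v)) p g"
  using p
proof (cases rule: ennreal_ge_1_cases)
  case 1
  have gm: "g \<in> borel_measurable (PM (u \<union> v))" using Lp_measurable[OF g] by simp
  define B where "B = Lp_norm (WM p (u \<union> v)) p g"
  have B: "0 \<le> B" by (simp add: B_def Lp_norm_nonneg)
  have "AE z in PM (u \<union> v). norm (g z) \<le> B"
    using Lp_top_iff[OF B, of g "WM p (u \<union> v)"] g unfolding B_def 1 WM_top by blast
  from AE_PiM_merge[OF uv this] have "AE x in PM u. norm (marg u v g x) \<le> m ^ card v * B"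
  proof (rule AE_mp, intro AE_I2 impI)
    fix x assume x: "x \<in> space (PM u)" and ae: "AE y in PM v. norm (g (merge u v (x, y))) \<le> B"
    note [measurable] = marg_slice_measurable[OF x gm]
    let ?f = "\<lambda>y. g (merge u v (x, y)) * of_real (\<Prod>j\<in>v. \<eta> (y j))"
    have ae': "AE y in PM v. norm (?f y) \<le> B * (\<Prod>j\<in>v. \<eta> (y j))"
      using ae
    proof eventually_elim
      case (elim y)
      have "norm (?f y) = norm (g (merge u v (x, y))) * (\<Prod>j\<in>v. \<eta> (y j))"
        by (simp add: norm_mult eta_ge0 prod_nonneg del: of_real_prod)
      with elim show ?case by (simp only: mult_right_mono prod_nonneg eta_ge0)
    qed
    have int: "integrable (PM v) (\<lambda>y. B * (\<Prod>j\<in>v. \<eta> (y j)))"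
      using prod_eta_int[OF uv(3)] by simp
    have intf: "integrable (PM v) ?f"
      by (rule Bochner_Integration.integrable_bound[OF int])
        (use ae' in \<open>auto elim!: eventually_mono order_trans intro: abs_ge_self\<close>)
    have "norm (marg u v g x) \<le> (LINT y|PM v. norm (?f y))"
      unfolding marg_def by (rule integral_norm_bound)
    also have "\<dots> \<le> (LINT y|PM v. B * (\<Prod>j\<in>v. \<eta> (y j)))"
      using intf int ae' by (intro integral_mono_AE) auto
    also have "\<dots> = m ^ card v * B" using integral_prod_eta[OF uv(3)] by simp
    finally show "norm (marg u v g x) \<le> m ^ card v * B" .
  qed
  moreover have "0 \<le> m ^ card v * B" using B m_ge0 by simp
  ultimately have *: "marg u v g \<in> Lp_space (WM p u) p \<and> Lp_norm (WM p u) p (marg u v g) \<le> m ^ card v * B"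
    using marg_measurable[OF uv(2,3) gm] unfolding 1 WM_top by (subst Lp_top_iff) auto
  \<comment> \<open>Here \<open>recip p = 0\<close>, and \<open>(\<kappa> ^ card v) powr 0\<close>
    equals 1 since \<kappa> is positive.\<close>
  with kappa_gt0 m_ge0 show ?thesis by (simp add: 1 B_def)
next
  case (2 r)
  have gm: "g \<in> borel_measurable (PM (u \<union> v))" using Lp_measurable[OF g] by simp
  define B where "B = Lp_norm (WM p (u \<union> v)) p g"
  have B: "0 \<le> B" by (simp add: B_def Lp_norm_nonneg)
  define K where "K = (\<kappa> ^ card v) powr (1/r) * (m ^ card v) powr (1 - 1/r)"
  have KB: "0 \<le> K * B" using B by (simp add: K_def)
  have "(\<integral>\<^sup>+x. ennreal (norm (marg u v g x) powr r) \<partial>WM p u)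
    \<le> ennreal ((m ^ card v) powr (r - 1) * \<kappa> ^ card v) * (\<integral>\<^sup>+z. ennreal (norm (g z) powr r) \<partial>WM p (u \<union> v))"
    unfolding 2 by (rule marg_Lp_finite[OF uv 2(1) gm])
  also have "\<dots> \<le> ennreal ((m ^ card v) powr (r - 1) * \<kappa> ^ card v) * ennreal (B powr r)"
    using Lp_finite_iff[OF 2(1) B, of g "WM p (u \<union> v)"] g by (intro mult_left_mono) (auto simp: 2 B_def)
  also have "\<dots> = ennreal ((K * B) powr r)"
  proof -
    have "(1 - 1/r) * r = r - 1" using 2 by (simp add: field_simps)
    then have "(K * B) powr r = (m ^ card v) powr (r - 1) * \<kappa> ^ card v * B powr r"
      using B 2 kappa_ge0 m_ge0 by (simp add: K_def powr_mult powr_powr)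
    then show ?thesis using kappa_ge0 by (simp flip: ennreal_mult)
  qed
  finally have "marg u v g \<in> Lp_space (WM p u) p \<and> Lp_norm (WM p u) p (marg u v g) \<le> K * B"
    using marg_measurable[OF uv(2,3) gm] unfolding 2 by (subst Lp_finite_iff[OF 2(1) KB]) simp
  then show ?thesis using 2 by (simp add: K_def B_def recip_ennreal)
qed

text \<open>On a probability space L_p is contained in L_1. The domination used for finite
  \<open>p\<close> is |g| \<le> 1 + |g|^r.\<close>

lemma Lp_psi_weighted_integrable:
  assumes u: "finite u" and p: "1 \<le> p" and g: "g \<in> Lp_space (WM p u) p"
  shows "integrable (PM u) (\<lambda>t. norm (g t :: complex) * (\<Prod>j\<in>u. \<psi> (t j)))"
  using p
proof (cases rule: ennreal_ge_1_cases)
  case 1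
  have gm [measurable]: "g \<in> borel_measurable (PM u)" using Lp_measurable[OF g] by simp
  define B where "B = Lp_norm (WM p u) p g"
  have B: "0 \<le> B" by (simp add: B_def Lp_norm_nonneg)
  have ae: "AE t in PM u. norm (g t) \<le> B"
    using Lp_top_iff[OF B, of g "WM p u"] g unfolding B_def 1 WM_top by blast
  have int: "integrable (PM u) (\<lambda>t. B * (\<Prod>j\<in>u. \<psi> (t j)))" using prod_psi_int[OF u] by simp
  show ?thesis
  proof (rule Bochner_Integration.integrable_bound[OF int])
    show "AE t in PM u. norm (norm (g t) * (\<Prod>j\<in>u. \<psi> (t j))) \<le> norm (B * (\<Prod>j\<in>u. \<psi> (t j)))"
      using ae by eventually_elim (simp add: abs_mult B mult_right_mono)
  qed measurable
next
  case (2 r)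
  have gm [measurable]: "g \<in> borel_measurable (PM u)" using Lp_measurable[OF g] by simp
  have "integrable (density (PM u) (\<lambda>t. ennreal (\<Prod>j\<in>u. \<psi> (t j)))) (\<lambda>t. norm (g t) powr r)"
    using g 2 by (simp add: WM_def Lp_space_def)
  then have "integrable (PM u) (\<lambda>t. (\<Prod>j\<in>u. \<psi> (t j)) * norm (g t) powr r)"
    by (subst (asm) integrable_density) (auto intro!: AE_I2 prod_psi_ge0)
  with prod_psi_int[OF u] have int: "integrable (PM u) (\<lambda>t. (\<Prod>j\<in>u. \<psi> (t j)) + (\<Prod>j\<in>u. \<psi> (t j)) * norm (g t) powr r)"
    by (rule Bochner_Integration.integrable_add)
  show ?thesis
  proof (rule Bochner_Integration.integrable_bound[OF int], measurable, intro AE_I2)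
    fix t assume t: "t \<in> space (PM u)"
    have "norm (g t) \<le> 1 + norm (g t) powr r"
    proof (cases "norm (g t) \<le> 1")
      case False
      then have "norm (g t) powr 1 \<le> norm (g t) powr r" using 2 by (intro powr_mono) auto
      then show ?thesis by simp
    qed (simp add: add_increasing2)
    from mult_right_mono[OF this prod_psi_ge0[OF t]]
    show "norm (norm (g t) * (\<Prod>j\<in>u. \<psi> (t j))) \<le> norm ((\<Prod>j\<in>u. \<psi> (t j)) + (\<Prod>j\<in>u. \<psi> (t j)) * norm (g t) powr r)"
      using prod_psi_ge0[OF t] by (simp add: algebra_simps)
  qed
qed

text \<open>A kernel bounded by a multiple of the density in every variable makes the integrand
  dominated by |g| times the product density, which is integrable for every \<open>p\<close>. Thus
  the condition for \<open>p = 1\<close> suffices for all exponents.\<close>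

lemma kernel_integrable:
  assumes u: "finite u" and p: "1 \<le> p" and g: "g \<in> Lp_space (WM p u) p"
    and km: "\<And>j. j \<in> u \<Longrightarrow> k j \<in> borel_measurable M"
    and k: "\<And>j. j \<in> u \<Longrightarrow> AE t in M. \<bar>k j t\<bar> \<le> C j * \<psi> t"
  shows "integrable (PM u) (\<lambda>t. g t * of_real (\<Prod>j\<in>u. k j (t j)) :: complex)"
proof -
  have gm [measurable]: "g \<in> borel_measurable (PM u)" using Lp_measurable[OF g] by simp
  note km[measurable]
  have int: "integrable (PM u) (\<lambda>t. (\<Prod>j\<in>u. C j) * (norm (g t) * (\<Prod>j\<in>u. \<psi> (t j))))"
    using Lp_psi_weighted_integrable[OF u p g] by simp
  show ?thesis
  proof (rule Bochner_Integration.integrable_bound[OF int])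
    show "AE t in PM u. norm (g t * of_real (\<Prod>j\<in>u. k j (t j)))
        \<le> norm ((\<Prod>j\<in>u. C j) * (norm (g t) * (\<Prod>j\<in>u. \<psi> (t j))))"
    proof (rule AE_mp[OF prod_kernel_bound[OF u, of k C]], rule k, assumption, intro AE_I2 impI)
      fix t assume "\<bar>\<Prod>j\<in>u. k j (t j)\<bar> \<le> (\<Prod>j\<in>u. C j) * (\<Prod>j\<in>u. \<psi> (t j))"
      then have "norm (g t) * \<bar>\<Prod>j\<in>u. k j (t j)\<bar> \<le> norm (g t) * ((\<Prod>j\<in>u. C j) * (\<Prod>j\<in>u. \<psi> (t j)))"
        by (intro mult_left_mono) auto
      also have "\<dots> \<le> norm ((\<Prod>j\<in>u. C j) * (norm (g t) * (\<Prod>j\<in>u. \<psi> (t j))))"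
        by (simp add: mult.left_commute)
      finally show "norm (g t * of_real (\<Prod>j\<in>u. k j (t j))) \<le> norm ((\<Prod>j\<in>u. C j) * (norm (g t) * (\<Prod>j\<in>u. \<psi> (t j))))"
        by (simp add: norm_mult del: of_real_prod)
    qed
  qed measurable
qed

lemma mixed_kernel_integrable:
  assumes uv: "u \<inter> v = {}" "finite u" "finite v" and p: "1 \<le> p"
    and g: "g \<in> Lp_space (WM p (u \<union> v)) p"
    and km: "\<And>j. j \<in> u \<Longrightarrow> k j \<in> borel_measurable M"
    and k: "\<And>j. j \<in> u \<Longrightarrow> AE t in M. \<bar>k j t\<bar> \<le> C j * \<psi> t"
  shows "integrable (PM (u \<union> v)) (\<lambda>z. g z * of_real ((\<Prod>j\<in>u. k j (z j)) * (\<Prod>j\<in>v. \<eta> (z j))) :: complex)"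
proof -
  \<comment> \<open>The factors \<eta> in the variables of \<open>v\<close> are merged with the
    given kernels into one product kernel on the union, for which integrability is known.\<close>
  define k' where "k' j = (if j \<in> u then k j else \<eta>)" for j
  define C' where "C' j = (if j \<in> u then C j else \<kappa>)" for j
  have k': "(\<Prod>j\<in>u \<union> v. k' j (z j)) = (\<Prod>j\<in>u. k j (z j)) * (\<Prod>j\<in>v. \<eta> (z j))" for z
  proof -
    have "(\<Prod>j\<in>v. k' j (z j)) = (\<Prod>j\<in>v. \<eta> (z j))"
      using uv by (intro prod.cong) (auto simp: k'_def)
    then show ?thesis using uv by (simp add: prod.union_disjoint k'_def)
  qed
  have "integrable (PM (u \<union> v)) (\<lambda>z. g z * of_real (\<Prod>j\<in>u \<union> v. k' j (z j)))"
  proof (rule kernel_integrable[OF _ p g])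
    show "AE t in M. \<bar>k' j t\<bar> \<le> C' j * \<psi> t" if "j \<in> u \<union> v" for j
      using k[of j] eta_le by (auto simp: k'_def C'_def eta_ge0)
  qed (use uv km in \<open>auto simp: k'_def\<close>)
  then show ?thesis by (simp only: k')
qed

lemma marg_Fubini:
  assumes uv: "u \<inter> v = {}" "finite u" "finite v" and p: "1 \<le> p"
    and g: "g \<in> Lp_space (WM p (u \<union> v)) p"
    and km: "\<And>j. j \<in> u \<Longrightarrow> k j \<in> borel_measurable M"
    and k: "\<And>j. j \<in> u \<Longrightarrow> AE t in M. \<bar>k j t\<bar> \<le> C j * \<psi> t"
  shows "(LINT x|PM u. marg u v g x * of_real (\<Prod>j\<in>u. k j (x j)))
    = (LINT z|PM (u \<union> v). g z * of_real ((\<Prod>j\<in>u. k j (z j)) * (\<Prod>j\<in>v. \<eta> (z j))))"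
proof -
  let ?m = "merge u v"
  have "(LINT z|PM (u \<union> v). g z * of_real ((\<Prod>j\<in>u. k j (z j)) * (\<Prod>j\<in>v. \<eta> (z j))))
      = (LINT x|PM u. LINT y|PM v. g (?m (x, y)) *
          of_real ((\<Prod>j\<in>u. k j (?m (x, y) j)) * (\<Prod>j\<in>v. \<eta> (?m (x, y) j))))"
    by (rule product_integral_fold[OF uv mixed_kernel_integrable[OF uv p g km k]])
  also have "\<dots> = (LINT x|PM u. marg u v g x * of_real (\<Prod>j\<in>u. k j (x j)))"
  proof (intro Bochner_Integration.integral_cong refl)
    fix x
    have "(\<Prod>j\<in>u. k j (?m (x, y) j)) = (\<Prod>j\<in>u. k j (x j))"
      "(\<Prod>j\<in>v. \<eta> (?m (x, y) j)) = (\<Prod>j\<in>v. \<eta> (y j))" for y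
      using uv by (auto intro!: prod.cong)
    then have "(LINT y|PM v. g (?m (x, y)) * of_real ((\<Prod>j\<in>u. k j (?m (x, y) j)) * (\<Prod>j\<in>v. \<eta> (?m (x, y) j))))
      = (LINT y|PM v. (g (?m (x, y)) * of_real (\<Prod>j\<in>v. \<eta> (y j))) * of_real (\<Prod>j\<in>u. k j (x j)))"
      by (simp add: mult_ac)
    also have "\<dots> = marg u v g x * of_real (\<Prod>j\<in>u. k j (x j))"
      unfolding marg_def by (rule integral_mult_left_zero)
    finally show "(LINT y|PM v. g (?m (x, y)) * of_real ((\<Prod>j\<in>u. k j (?m (x, y) j)) * (\<Prod>j\<in>v. \<eta> (?m (x, y) j))))
      = marg u v g x * of_real (\<Prod>j\<in>u. k j (x j))" .
  qed
  finally show ?thesis by (rule sym)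
qed

lemma marg_AE_zero:
  assumes uv: "u \<inter> v = {}" "finite u" "finite v" and g: "AE z in PM (u \<union> v). g z = 0"
  shows "AE x in PM u. marg u v g x = 0"
  using AE_PiM_merge[OF uv g]
proof eventually_elim
  case (elim x)
  then show ?case unfolding marg_def by (intro integral_eq_zero_AE) auto
qed

end

section \<open>The weighted interval\<close>

locale weighted_interval =
  fixes D :: "real set" and \<psi> :: "real \<Rightarrow> real"
  assumes D: "interval_dom D" and dens: "prob_density_on D \<psi>" and cond: "integrability_cond D \<psi> 1"
begin

lemma D_sets [measurable]: "D \<in> sets borel"
  using D unfolding interval_dom_def by auto

lemma D_nonneg: "t \<in> D \<Longrightarrow> 0 \<le> t"
  using D unfolding interval_dom_def by auto

lemma D_zero: "0 \<in> D"
  using D unfolding interval_dom_def by auto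

lemma D_down: "t \<in> D" if "x \<in> D" "0 \<le> t" "t \<le> x"
  using that D unfolding interval_dom_def by auto

lemma space_leb [simp]: "space (leb D) = D"
  by (simp add: space_restrict_space)

sublocale product_sigma_finite "\<lambda>_::nat. leb D"
  by unfold_locales (intro sigma_finite_measure.sigma_finite_countable
      sigma_finite_measure_restrict_space lborel.sigma_finite_measure_axioms; simp)

lemma psi_measurable [measurable]: "\<psi> \<in> borel_measurable (leb D)"
  using dens by (simp add: prob_density_on_def)

lemma psi_nonneg: "t \<in> D \<Longrightarrow> 0 \<le> \<psi> t"
  using dens by (simp add: prob_density_on_def)

lemma psi_pos: "AE t in leb D. 0 < \<psi> t"
  using dens by (simp add: prob_density_on_def)

lemma nn_integral_psi: "(\<integral>\<^sup>+t. ennreal (\<psi> t) \<partial>leb D) = 1"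
proof -
  have "emeasure (density (leb D) (\<lambda>t. ennreal (\<psi> t))) (space (density (leb D) (\<lambda>t. ennreal (\<psi> t)))) = 1"
    using dens prob_space.emeasure_space_1 unfolding prob_density_on_def by blast
  then have "(\<integral>\<^sup>+t. ennreal (\<psi> t) * indicator D t \<partial>leb D) = 1"
    by (subst (asm) emeasure_density) (auto simp: sets_restrict_space)
  moreover have "(\<integral>\<^sup>+t. ennreal (\<psi> t) * indicator D t \<partial>leb D) = (\<integral>\<^sup>+t. ennreal (\<psi> t) \<partial>leb D)"
    by (intro nn_integral_cong) (auto simp: indicator_def)
  ultimately show ?thesis by simp
qed

lemma psi_integrable: "integrable (leb D) \<psi>"
  using nn_integral_psi psi_nonneg by (intro integrableI_nonneg) (auto intro: AE_I2)

abbreviation psibar :: "real \<Rightarrow> real" where "psibar \<equiv> psi_bar D \<psi>"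

lemma psibar_eq: "psibar t = (LINT y|leb D. indicator {t..} y * \<psi> y)"
proof -
  have "psibar t = (LINT y|lborel. indicator D y *\<^sub>R (indicator {t..} y * \<psi> y))"
    unfolding psi_bar_def set_lebesgue_integral_def
    by (intro Bochner_Integration.integral_cong) (auto simp: indicator_def)
  then show ?thesis
    by (simp add: integral_restrict_space)
qed

lemma psibar_integrand: "integrable (leb D) (\<lambda>y. indicator {t..} y * \<psi> y)"
proof -
  have "{t..} \<inter> D \<in> sets (leb D)" by (auto simp: sets_restrict_space)
  then have "integrable (leb D) (\<lambda>y. indicator ({t..} \<inter> D) y *\<^sub>R \<psi> y)"
    by (intro integrable_mult_indicator psi_integrable)
  then show ?thesis
    by (rule Bochner_Integration.integrable_cong[THEN iffD1, rotated -1]) (auto simp: indicator_def)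
qed

lemma psibar_nonneg: "0 \<le> psibar t"
  unfolding psibar_eq by (intro integral_nonneg_AE AE_I2 mult_nonneg_nonneg) (auto intro: psi_nonneg)

lemma psibar_antimono: "s \<le> t \<Longrightarrow> psibar t \<le> psibar s"
  unfolding psibar_eq
  by (intro integral_mono psibar_integrand) (auto simp: indicator_def psi_nonneg)

lemma psibar_measurable: "psibar \<in> borel_measurable borel"
proof -
  have "(\<lambda>t. - psibar t) \<in> borel_measurable borel"
    by (intro borel_measurable_mono) (auto simp: mono_def psibar_antimono)
  from borel_measurable_uminus[OF this] show ?thesis by simp
qed

lemma measurable_leb: "f \<in> borel_measurable borel \<Longrightarrow> f \<in> borel_measurable (leb D)"
  by (rule measurable_restrict_space1) simp

lemma psibar_measurable_leb [measurable]: "psibar \<in> borel_measurable (leb D)"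
  by (rule measurable_leb) (rule psibar_measurable)

section \<open>Domination of \<open>psi_bar\<close> and of the kernels by the density\<close>

abbreviation \<kappa> :: real where "\<kappa> \<equiv> kappa_const D \<psi>"
abbreviation m :: real where "m \<equiv> m_const D \<psi>"

lemma kappa_nonneg: "0 \<le> \<kappa>"
  by (simp add: kappa_const_def Lp_norm_def)

lemma recip_1 [simp]: "recip 1 = 1" and conj_index_1: "conj_index 1 = \<infinity>"
  by (simp_all add: recip_def conj_index_def divide_ennreal_def)

text \<open>Also correct where \<psi> vanishes: then both sides are 0 by the conventions for
  \<open>powr\<close> and division.\<close>

lemma psi_powr_minus_1: "t \<in> D \<Longrightarrow> \<psi> t powr -1 = 1 / \<psi> t"
  using psi_nonneg[of t] by (simp add: powr_minus_divide)

lemma psibar_le_kappa: "AE t in leb D. psibar t \<le> \<kappa> * \<psi> t"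
proof -
  let ?f = "\<lambda>t. psibar t / \<psi> t" and ?g = "\<lambda>t. psibar t * \<psi> t powr - 1"
  have "?g \<in> Lp_space (leb D) \<infinity>"
    using cond by (simp add: integrability_cond_def conj_index_1)
  then have g: "esssup (leb D) (\<lambda>t. ennreal (norm (?g t))) < \<infinity>"
    by (simp add: Lp_space_def)
  have "esssup (leb D) (\<lambda>t. ennreal (norm (?f t))) = esssup (leb D) (\<lambda>t. ennreal (norm (?g t)))"
    by (intro esssup_AE_cong AE_I2 measurable_compose[OF _ measurable_ennreal] borel_measurable_norm
        borel_measurable_divide borel_measurable_times powr_real_measurable
        psibar_measurable_leb psi_measurable borel_measurable_const) (auto simp: psi_powr_minus_1)
  \<comment> \<open>Finiteness from the integrability condition matters here: otherwise
    \<open>enn2real\<close> would make \<kappa> equal to 0 and the bound would fail.\<close>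
  with g have "ennreal \<kappa> = esssup (leb D) (\<lambda>t. ennreal (norm (?f t)))"
    by (simp add: kappa_const_def Lp_norm_def)
  then have "AE t in leb D. ennreal (norm (?f t)) \<le> ennreal \<kappa>"
    using esssup_AE[of "\<lambda>t. ennreal (norm (?f t))" "leb D"] by simp
  with psi_pos show ?thesis
    by eventually_elim (simp add: psibar_nonneg kappa_nonneg field_simps)
qed

lemma psibar_integrable: "integrable (leb D) psibar"
  by (rule Bochner_Integration.integrable_bound[where f="\<lambda>t. \<kappa> * \<psi> t"])
    (use psibar_le_kappa psi_integrable in \<open>auto simp: psibar_nonneg elim!: eventually_mono\<close>)

lemma m_nonneg: "0 \<le> m"
  unfolding m_const_def by (simp add: psibar_nonneg)

lemma kernel1_measurable [measurable]: "kernel1 k D \<psi> x \<in> borel_measurable (leb D)"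
proof (rule measurable_leb)
  show "kernel1 k D \<psi> x \<in> borel_measurable borel"
  proof (cases k)
    case Anchored
    have "kernel1 k D \<psi> x = indicator {0..<x}" by (simp add: Anchored fun_eq_iff)
    then show ?thesis by (simp del: kernel1.simps)
  next
    case ANOVA
    have "kernel1 k D \<psi> x = (\<lambda>t. indicator {0..<x} t - psibar t)" by (simp add: ANOVA fun_eq_iff)
    then show ?thesis using psibar_measurable by (simp del: kernel1.simps)
  qed
qed

text \<open>For \<open>p = 1\<close> the local part of the integrability condition bounds 1/\<psi>
  on [0,x), that is, it bounds \<psi> from below there.\<close>

lemma indicator_le_psi:
  assumes x: "x \<in> D"
  shows "\<exists>C\<ge>0. AE t in leb D. indicator {0..<x} t \<le> C * \<psi> t"
proof -
  let ?g = "\<lambda>t. \<psi> t powr - 1"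
  have "?g \<in> Lp_space (leb {0..<x}) \<infinity>"
    using cond x by (simp add: integrability_cond_def conj_index_1 Lp_loc_def)
  then have g: "esssup (leb {0..<x}) (\<lambda>t. ennreal (norm (?g t))) < \<infinity>"
    by (simp add: Lp_space_def)
  define C where "C = enn2real (esssup (leb {0..<x}) (\<lambda>t. ennreal (norm (?g t))))"
  have "AE t in leb {0..<x}. ennreal (norm (?g t)) \<le> ennreal C"
    using esssup_AE[of "\<lambda>t. ennreal (norm (?g t))" "leb {0..<x}"] g by (simp add: C_def)
  moreover have C: "0 \<le> C" by (simp add: C_def)
  \<comment> \<open>The two restricted measures are compared through Lebesgue measure on the whole
    line.\<close>
  ultimately have "AE t in lborel. t \<in> {0..<x} \<longrightarrow> ?g t \<le> C"
    by (simp add: AE_restrict_space_iff)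
  then have "AE t in leb D. t \<in> {0..<x} \<longrightarrow> ?g t \<le> C"
    by (subst AE_restrict_space_iff) (auto elim!: eventually_mono)
  with psi_pos have "AE t in leb D. indicator {0..<x} t \<le> C * \<psi> t"
  proof eventually_elim
    case (elim t)
    with C show ?case
      by (auto simp: indicator_def powr_minus_divide field_simps)
  qed
  with C show ?thesis by blast
qed

lemma kernel1_le_psi:
  assumes x: "x \<in> D"
  shows "\<exists>C\<ge>0. AE t in leb D. \<bar>kernel1 k D \<psi> x t\<bar> \<le> C * \<psi> t"
proof -
  obtain C where C: "C \<ge> 0" "AE t in leb D. indicator {0..<x} t \<le> C * \<psi> t"
    using indicator_le_psi[OF x] by auto
  have "AE t in leb D. \<bar>kernel1 k D \<psi> x t\<bar> \<le> (C + \<kappa>) * \<psi> t"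
    using C(2) psibar_le_kappa psi_pos
  proof eventually_elim
    case (elim t)
    then have "0 \<le> \<kappa> * \<psi> t" "0 \<le> C * \<psi> t"
      using C(1) kappa_nonneg by auto
    with elim psibar_nonneg[of t] show ?case
      by (cases k) (auto simp: algebra_simps abs_le_iff add_increasing2 add_increasing intro: order_trans)
  qed
  with C kappa_nonneg show ?thesis by (intro exI[of _ "C + \<kappa>"]) auto
qed

end

section \<open>Uniqueness of the components\<close>

context weighted_interval
begin

section \<open>Strict positivity of \<open>m\<close> and \<kappa>\<close>

lemma ex_psibar_pos: "\<exists>t\<in>D. 0 < t \<and> 0 < psibar t"
proof -
  obtain t e where t: "t \<in> D" "0 < t" "0 < e" "{t..t+e} \<subseteq> D"
  proof (cases "D = {0..}")
    case True
    show ?thesis by (rule that[of 1 1]) (auto simp: True)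
  next
    case False
    then obtain T where "0 < T" "D = {0..<T} \<or> D = {0..T}"
      using D unfolding interval_dom_def by auto
    then have "0 < T" "{0..<T} \<subseteq> D" by auto
    then show ?thesis by (intro that[of "T/4" "T/4"]) (auto simp: subset_iff)
  qed
  \<comment> \<open>A vanishing tail integral would force \<psi> to be 0 almost everywhere on
    {t..t+e}, an interval of positive length inside \<open>D\<close>.\<close>
  have "psibar t \<noteq> 0"
  proof
    assume "psibar t = 0"
    then have "AE y in leb D. indicator {t..} y * \<psi> y = 0"
      unfolding psibar_eq
      by (subst (asm) integral_nonneg_eq_0_iff_AE)
        (auto intro!: psibar_integrand AE_I2 mult_nonneg_nonneg psi_nonneg)
    with psi_pos have "AE y in leb D. y \<notin> {t..}"
      by eventually_elim (auto simp: indicator_def split: if_splits)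
    then have "AE y in lborel. y \<notin> {t..t+e}"
      using t by (subst (asm) AE_restrict_space_iff) (auto elim!: eventually_mono)
    then have "{t..t+e} \<in> null_sets lborel"
      by (subst AE_iff_null_sets) auto
    then show False using t by (auto simp: null_sets_def)
  qed
  with psibar_nonneg[of t] t show ?thesis by (intro bexI[of _ t]) auto
qed

text \<open>The function \<open>psibar\<close> is decreasing, so a positive value at
  \<open>t\<close> bounds it from below on the whole of [0,t]. Positivity of \<open>m\<close> and
  \<kappa> makes all matrix entries positive.\<close>

lemma m_pos: "0 < m"
proof -
  obtain t where t: "t \<in> D" "0 < t" "0 < psibar t" using ex_psibar_pos by auto
  have "m \<noteq> 0"
  proof
    assume "m = 0"
    then have "AE y in leb D. psibar y = 0"
      unfolding m_const_def
      by (subst (asm) integral_nonneg_eq_0_iff_AE) (auto intro!: psibar_integrable AE_I2 psibar_nonneg)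
    then have "AE y in lborel. y \<in> D \<longrightarrow> psibar y = 0"
      by (subst (asm) AE_restrict_space_iff) auto
    then have "AE y in lborel. y \<notin> {0..t}"
    proof eventually_elim
      case (elim y)
      then show ?case
        using D_down[OF t(1), of y] psibar_antimono[of y t] t(3) by auto
    qed
    then have "{0..t} \<in> null_sets lborel"
      by (subst AE_iff_null_sets) auto
    then show False using t by (auto simp: null_sets_def)
  qed
  with m_nonneg show ?thesis by simp
qed

text \<open>Integrating \<open>psibar\<close> \<le> \<kappa>\<psi> shows that \<kappa> = 0 would
  contradict \<open>m_pos\<close>.\<close>

lemma kappa_pos: "0 < \<kappa>"
proof -
  have "m \<le> (LINT t|leb D. \<kappa> * \<psi> t)"
    unfolding m_const_def using psibar_le_kappa psibar_integrable psi_integrable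
    by (intro integral_mono_AE) auto
  then have "m \<le> \<kappa> * (LINT t|leb D. \<psi> t)" by simp
  with m_pos have "\<kappa> \<noteq> 0" by auto
  with kappa_nonneg show ?thesis by simp
qed

sublocale pair: density_pair "leb D" \<psi> psibar \<kappa>
  by unfold_locales (use psi_nonneg in \<open>auto intro: psi_measurable psibar_measurable_leb psi_pos
      nn_integral_psi psibar_nonneg kappa_pos psibar_le_kappa\<close>)

section \<open>Box integrals determine a function\<close>

lemma sets_leb_generator: "sets (leb D) = sigma_sets D (range (\<lambda>a. D \<inter> {..<a}))"
proof -
  have "sets (leb D) = (\<inter>) D ` sigma_sets UNIV (range lessThan)"
    by (simp add: sets_restrict_space borel_Iio)
  also have "\<dots> = sigma_sets D ((\<inter>) D ` range lessThan)"
  proof (rule sigma_sets_Int)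
    have "D \<in> sets borel" by (rule D_sets)
    then show "D \<in> sigma_sets UNIV (range lessThan)" by (simp add: borel_Iio)
  qed simp
  finally show ?thesis by (simp add: image_image)
qed

text \<open>Boxes form an intersection-stable generator, as the monotone class argument below
  requires. The corners \<open>a\<close> range over all real vectors; they are moved into
  \<open>D\<close> only when a box integral is evaluated.\<close>

lemma sets_leb_prod_generator:
  assumes u: "finite u"
  shows "sets (leb_prod D u) = sigma_sets (\<Pi>\<^sub>E j\<in>u. D) (range (\<lambda>a. \<Pi>\<^sub>E j\<in>u. D \<inter> {..<a j}))"
proof -
  have eq: "{f \<in> \<Pi>\<^sub>E j\<in>u. D. \<forall>i\<in>u. f i \<in> D \<inter> {..<a i}} = (\<Pi>\<^sub>E j\<in>u. D \<inter> {..<a j})" for a :: "nat \<Rightarrow> real"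
      by (auto simp: PiE_def Pi_def)
  let ?E = "range (\<lambda>a. D \<inter> {..<a})"
  have "sets (leb_prod D u) = sets (\<Pi>\<^sub>M j\<in>u. sigma D ?E)"
    by (intro sets_PiM_cong refl) (simp only: sets_leb_generator, subst sets_measure_of, auto)
  also have "\<dots> = sets (sigma (\<Pi>\<^sub>E j\<in>u. D)
      {{f \<in> \<Pi>\<^sub>E j\<in>u. D. \<forall>i\<in>j. f i \<in> A i} | A j. j \<in> {u} \<and> A \<in> Pi j (\<lambda>_. ?E)})"
  proof (rule sets_PiM_sigma)
    show "\<exists>S\<subseteq>?E. countable S \<and> D = \<Union>S" for i
      by (intro exI[of _ "range (\<lambda>n. D \<inter> {..<real n})"]) (auto simp: reals_Archimedean2)
  qed (use u in auto)
  also have "{{f \<in> \<Pi>\<^sub>E j\<in>u. D. \<forall>i\<in>j. f i \<in> A i} | A j. j \<in> {u} \<and> A \<in> Pi j (\<lambda>_. ?E)}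
      = range (\<lambda>a. \<Pi>\<^sub>E j\<in>u. D \<inter> {..<a j})" (is "?L = ?R")
  proof (intro equalityI subsetI)
    fix B assume "B \<in> ?L"
    then obtain A where A: "A \<in> Pi u (\<lambda>_. ?E)" "B = {f \<in> \<Pi>\<^sub>E j\<in>u. D. \<forall>i\<in>u. f i \<in> A i}" by auto
    then have "\<forall>i\<in>u. \<exists>a. A i = D \<inter> {..<a}" by auto
    then obtain a where "\<forall>i\<in>u. A i = D \<inter> {..<a i}" by metis
    with A have "B = {f \<in> \<Pi>\<^sub>E j\<in>u. D. \<forall>i\<in>u. f i \<in> D \<inter> {..<a i}}" by simp
    then have "B = (\<Pi>\<^sub>E j\<in>u. D \<inter> {..<a j})" by (simp only: eq)
    then show "B \<in> ?R" by auto
  next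
    fix B assume "B \<in> ?R"
    then obtain a where B: "B = (\<Pi>\<^sub>E j\<in>u. D \<inter> {..<a j})" by auto
    then have "B = {f \<in> \<Pi>\<^sub>E j\<in>u. D. \<forall>i\<in>u. f i \<in> D \<inter> {..<a i}}" by (simp only: eq)
    then show "B \<in> ?L"
      by (intro CollectI exI[of _ "\<lambda>i. D \<inter> {..<a i}"] exI[of _ u]) simp
  qed
  also have "sets (sigma (\<Pi>\<^sub>E j\<in>u. D) (range (\<lambda>a. \<Pi>\<^sub>E j\<in>u. D \<inter> {..<a j})))
      = sigma_sets (\<Pi>\<^sub>E j\<in>u. D) (range (\<lambda>a. \<Pi>\<^sub>E j\<in>u. D \<inter> {..<a j}))"
  proof (rule sets_measure_of)
    have "(\<Pi>\<^sub>E j\<in>u. D \<inter> {..<a j}) \<subseteq> (\<Pi>\<^sub>E j\<in>u. D)" for a :: "nat \<Rightarrow> real"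
      by (rule PiE_mono) auto
    then show "range (\<lambda>a. \<Pi>\<^sub>E j\<in>u. D \<inter> {..<a j}) \<subseteq> Pow (\<Pi>\<^sub>E j\<in>u. D)" by blast
  qed
  finally show ?thesis .
qed

text \<open>If \<open>D = {0..T}\<close>, then no box \<open>{0..<x}\<close> with \<open>x \<in> D\<close> contains the point \<open>T\<close>.\<close>

lemma leb_nonmax: "AE t in leb D. \<exists>y\<in>D. t < y"
proof -
  obtain T where T: "\<And>t. t \<in> D \<Longrightarrow> t \<noteq> T \<Longrightarrow> \<exists>y\<in>D. t < y"
  proof (cases "\<exists>T\<in>D. \<forall>t\<in>D. t \<le> T")
    case True
    then show ?thesis using that by (metis le_less)
  next
    case False
    then show ?thesis using that[of 0] by (metis not_le)
  qed
  have "AE t in lborel. t \<in> D \<longrightarrow> (\<exists>y\<in>D. t < y)"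
    using AE_lborel_singleton[of T] by eventually_elim (use T in auto)
  then show ?thesis by (subst AE_restrict_space_iff) auto
qed

text \<open>Only the restrictions of \<open>g\<close> to boxes are known to be integrable. So a box
  is fixed first, and a monotone class argument shows that the restriction has integral 0 over every
  measurable set and hence vanishes almost everywhere. Countably many boxes then exhaust almost all
  of the domain.\<close>

lemma AE_zero_if_box_integrals_zero:
  fixes g :: "(nat \<Rightarrow> real) \<Rightarrow> complex"
  assumes u: "finite u"
    and int: "\<And>x. x \<in> (\<Pi>\<^sub>E j\<in>u. D) \<Longrightarrow>
      integrable (leb_prod D u) (\<lambda>t. g t * of_real (\<Prod>j\<in>u. indicator {0..<x j} (t j)))"
    and zero: "\<And>x. x \<in> (\<Pi>\<^sub>E j\<in>u. D) \<Longrightarrow>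
      (LINT t|leb_prod D u. g t * of_real (\<Prod>j\<in>u. indicator {0..<x j} (t j))) = 0"
  shows "AE t in leb_prod D u. g t = 0"
proof -
  interpret F: finite_product_sigma_finite "\<lambda>_::nat. leb D" u by standard fact
  let ?P = "leb_prod D u" and ?\<Omega> = "\<Pi>\<^sub>E j\<in>u. D"
  let ?k = "\<lambda>x t. (\<Prod>j\<in>u. indicator {0..<x j} (t j)) :: real"
  have space: "space ?P = ?\<Omega>" by (simp add: space_PiM)
  have box: "AE t in ?P. g t * of_real (?k x t) = 0" if x: "x \<in> ?\<Omega>" for x
  proof (rule F.density_zero[OF int[OF x]])
    let ?h = "\<lambda>t. g t * of_real (?k x t)"
    let ?G = "range (\<lambda>a. \<Pi>\<^sub>E j\<in>u. D \<inter> {..<a j})"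
    have set_int: "set_integrable ?P A ?h" if "A \<in> sets ?P" for A
      unfolding set_integrable_def by (intro integrable_mult_indicator int x that)
    fix A assume "A \<in> sets ?P"
    then have A: "A \<in> sigma_sets ?\<Omega> ?G" by (simp add: sets_leb_prod_generator[OF u])
    have "Int_stable ?G"
    proof (rule Int_stableI)
      fix a b assume "a \<in> ?G" "b \<in> ?G"
      then obtain a' b' where ab: "a = (\<Pi>\<^sub>E j\<in>u. D \<inter> {..<a' j})" "b = (\<Pi>\<^sub>E j\<in>u. D \<inter> {..<b' j})" by auto
      have "a \<inter> b = (\<Pi>\<^sub>E j\<in>u. D \<inter> {..<min (a' j) (b' j)})"
        unfolding ab PiE_Int by (intro PiE_cong) auto
      then show "a \<inter> b \<in> ?G" by auto
    qed
    moreover have "?G \<subseteq> Pow ?\<Omega>" by (auto simp: PiE_iff)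
    ultimately show "set_lebesgue_integral ?P A ?h = 0"
      using A
    proof (induction rule: sigma_sets_induct_disjoint)
      case (basic A)
      then obtain a where A: "A = (\<Pi>\<^sub>E j\<in>u. D \<inter> {..<a j})" by auto
      \<comment> \<open>Intersecting [0,x) with the generator gives the box [0,y) with this corner.
        The maximum with 0 keeps \<open>y\<close> in \<open>D\<close>; a negative \<open>a j\<close>
        yields the empty interval, as it should.\<close>
      define y where "y = (\<lambda>j\<in>u. min (x j) (max 0 (a j)))"
      have y: "y \<in> ?\<Omega>"
      proof -
        have "min (x j) (max 0 (a j)) \<in> D" if "j \<in> u" for j
        proof -
          have "x j \<in> D" using x that by auto
          then show ?thesis by (rule D_down) (use D_nonneg[OF \<open>x j \<in> D\<close>] in auto)
        qed
        then show ?thesis by (auto simp: y_def)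
      qed
      have "set_lebesgue_integral ?P A ?h = (LINT t|?P. g t * of_real (?k y t))"
        unfolding set_lebesgue_integral_def
      proof (intro Bochner_Integration.integral_cong refl)
        fix t assume t: "t \<in> space ?P"
        have "?k y t = indicator A t * ?k x t"
        proof (cases "t \<in> A")
          case True
          then have "indicator {0..<y j} (t j) = (indicator {0..<x j} (t j) :: real)" if "j \<in> u" for j
            using that by (auto simp: A y_def PiE_iff indicator_def)
          with True show ?thesis by simp
        next
          case False
          then obtain j where "j \<in> u" "\<not> t j < a j"
            using t by (auto simp: A space PiE_iff)
          then have "?k y t = 0"
            using u t D_nonneg by (intro prod_zero) (auto simp: y_def indicator_def intro!: bexI[of _ j])
          with False show ?thesis by simp
        qed
        then show "indicator A t *\<^sub>R ?h t = g t * of_real (?k y t)"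
          by (simp add: scaleR_conv_of_real mult_ac del: of_real_prod)
      qed
      then show ?case using zero[OF y] by simp
    next
      case empty
      show ?case by (simp add: set_lebesgue_integral_def)
    next
      case (compl A)
      then have A: "A \<in> sets ?P" by (simp add: sets_leb_prod_generator[OF u])
      \<comment> \<open>For complements one also needs that the integral over the whole space
        vanishes, which is the hypothesis for the box [0,x) itself.\<close>
      have "set_lebesgue_integral ?P (?\<Omega> - A) ?h = (LINT t|?P. ?h t - indicator A t *\<^sub>R ?h t)"
        unfolding set_lebesgue_integral_def
        by (intro Bochner_Integration.integral_cong refl) (auto simp: indicator_def space)
      also have "\<dots> = (LINT t|?P. ?h t) - set_lebesgue_integral ?P A ?h"
        using int[OF x] set_int[OF A] unfolding set_lebesgue_integral_def set_integrable_def
        by (rule Bochner_Integration.integral_diff)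
      finally show ?case using zero[OF x] compl by simp
    next
      case (union A)
      then have A: "A i \<in> sets ?P" for i by (auto simp: sets_leb_prod_generator[OF u])
      have "set_lebesgue_integral ?P (\<Union>i. A i) ?h = (\<Sum>i. set_lebesgue_integral ?P (A i) ?h)"
        using union A
        by (intro lebesgue_integral_countable_add set_int) (auto simp: disjoint_family_on_def)
      with union show ?case by simp
    qed
  qed
  \<comment> \<open>Cubes with equal rational side lengths are countably many. They reach every
    point none of whose coordinates is the maximum of \<open>D\<close>.\<close>
  define Q where "Q = D \<inter> \<rat>"
  have "countable Q" by (simp add: Q_def countable_rat)
  then have "AE t in ?P. \<forall>r\<in>Q. g t * of_real (?k (\<lambda>j\<in>u. r) t) = 0"
    by (intro AE_ball_countable[THEN iffD2] ballI box) (auto simp: Q_def)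
  moreover have "AE t in ?P. \<forall>j\<in>u. \<exists>y\<in>D. t j < y"
    by (intro AE_PiM_finite_components u leb_nonmax)
  moreover have "AE t in ?P. t \<in> ?\<Omega>" by (rule AE_I2) (simp add: space)
  ultimately show ?thesis
  proof eventually_elim
    case (elim t)
    have "\<exists>r\<in>Q. \<forall>j\<in>u. t j < r"
    proof (cases "u = {}")
      case True
      then show ?thesis using D_zero by (auto simp: Q_def)
    next
      case False
      let ?M = "Max (t ` u)"
      have "?M \<in> t ` u" using u False by (intro Max_in) auto
      then obtain j where j: "j \<in> u" "?M = t j" by auto
      then obtain y where y: "y \<in> D" "?M < y" using elim(2) by auto
      obtain r where r: "r \<in> \<rat>" "?M < r" "r < y" using Rats_dense_in_real[OF y(2)] by auto
      have "0 \<le> ?M" using elim(3) j D_nonneg by (auto simp: PiE_iff)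
      then have "r \<in> D" using r by (intro D_down[OF y(1)]) auto
      moreover have "t i < r" if "i \<in> u" for i
        using Max_ge[of "t ` u" "t i"] u that by (intro le_less_trans[OF _ r(2)]) auto
      ultimately show ?thesis using r by (auto simp: Q_def)
    qed
    then obtain r where r: "r \<in> Q" "\<forall>j\<in>u. t j < r" by auto
    then have "?k (\<lambda>j\<in>u. r) t = 1"
      using elim(3) D_nonneg by (intro prod.neutral) (auto simp: indicator_def PiE_iff)
    then show ?case using elim(1) r(1) by (auto simp del: of_real_prod)
  qed
qed

end

section \<open>Changing between the two decompositions\<close>

fun other :: "kind \<Rightarrow> kind" where
  "other Anchored = ANOVA"
| "other ANOVA = Anchored"

text \<open>The sign with which \<open>psi_bar\<close> enters when the kernel of the given kind is
  expressed by the other one.\<close>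

fun ksign :: "kind \<Rightarrow> real" where
  "ksign Anchored = 1"
| "ksign ANOVA = -1"

lemma other_other [simp]: "other (other k) = k"
  by (cases k) auto

lemma Lp_scale:
  fixes f :: "'a \<Rightarrow> complex"
  assumes f: "f \<in> Lp_space N p" and c: "norm c = 1"
  shows "(\<lambda>x. c * f x) \<in> Lp_space N p" "Lp_norm N p (\<lambda>x. c * f x) = Lp_norm N p f"
  using f c by (auto simp: Lp_space_def Lp_norm_def norm_mult)

lemma Lp_diff:
  fixes f g :: "'a \<Rightarrow> complex"
  assumes p: "1 \<le> p" and f: "f \<in> Lp_space N p" and g: "g \<in> Lp_space N p"
  shows "(\<lambda>x. f x - g x) \<in> Lp_space N p"
proof -
  \<comment> \<open>The difference is written as a sum over the two-element index type
    \<open>bool\<close>, so that Minkowski's inequality applies.\<close>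
  let ?h = "\<lambda>b x. if b then f x else - 1 * g x"
  have "(\<lambda>x. \<Sum>b\<in>UNIV. ?h b x) \<in> Lp_space N p \<and>
      Lp_norm N p (\<lambda>x. \<Sum>b\<in>UNIV. ?h b x) \<le> (\<Sum>b\<in>UNIV. Lp_norm N p (?h b))"
  proof (rule Lp_sum[OF p])
    show "?h b \<in> Lp_space N p" for b
      using f Lp_scale(1)[OF g, of "-1"] by (cases b) auto
  qed auto
  then show ?thesis by (simp add: UNIV_bool)
qed

context weighted_interval
begin

lemma Lp_psi_measure_eq: "Lp_psi_measure D \<psi> p u = pair.WM p u"
  by (simp add: Lp_psi_measure_def pair.WM_def)

lemma Lp_psi_eq: "Lp_psi D \<psi> p u = Lp_space (pair.WM p u) p"
  by (simp add: Lp_psi_def Lp_psi_measure_eq)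

lemma Lp_psi_norm_eq: "Lp_psi_norm D \<psi> p u = Lp_norm (pair.WM p u) p"
  by (simp add: Lp_psi_norm_def[abs_def] Lp_psi_measure_eq)

lemma kernel1_other: "kernel1 k D \<psi> x t = kernel1 (other k) D \<psi> x t + ksign k * psibar t"
  by (cases k) auto

lemma T_op_integrable:
  assumes u: "finite u" and p: "1 \<le> p" and g: "g \<in> Lp_psi D \<psi> p u" and x: "\<And>j. j \<in> u \<Longrightarrow> x j \<in> D"
  shows "integrable (leb_prod D u) (\<lambda>t. g t * of_real (prod_kernel k D \<psi> u x t))"
proof -
  have "\<forall>j\<in>u. \<exists>C. AE t in leb D. \<bar>kernel1 k D \<psi> (x j) t\<bar> \<le> C * \<psi> t"
    using kernel1_le_psi x by blast
  then obtain C where "\<And>j. j \<in> u \<Longrightarrow> AE t in leb D. \<bar>kernel1 k D \<psi> (x j) t\<bar> \<le> C j * \<psi> t"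
    by metis
  then show ?thesis
    unfolding prod_kernel_def
    using g by (intro pair.kernel_integrable[OF u p]) (auto simp: Lp_psi_eq intro: kernel1_measurable)
qed

lemma T_op_sum:
  assumes u: "finite u" and p: "1 \<le> p" and g: "\<And>i. i \<in> I \<Longrightarrow> g i \<in> Lp_psi D \<psi> p u"
    and x: "\<And>j. j \<in> u \<Longrightarrow> x j \<in> D"
  shows "T_op k D \<psi> u (\<lambda>t. \<Sum>i\<in>I. c i * g i t) x = (\<Sum>i\<in>I. c i * T_op k D \<psi> u (g i) x)"
proof -
  have "T_op k D \<psi> u (\<lambda>t. \<Sum>i\<in>I. c i * g i t) x
      = (LINT t|leb_prod D u. (\<Sum>i\<in>I. c i * (g i t * of_real (prod_kernel k D \<psi> u x t))))"
    by (simp add: T_op_def sum_distrib_right mult.assoc)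
  also have "\<dots> = (\<Sum>i\<in>I. LINT t|leb_prod D u. c i * (g i t * of_real (prod_kernel k D \<psi> u x t)))"
    by (intro Bochner_Integration.integral_sum integrable_mult_right T_op_integrable[OF u p] g x)
  finally show ?thesis by (simp add: T_op_def)
qed

lemma T_op_cong: "(\<And>j. j \<in> u \<Longrightarrow> x j = y j) \<Longrightarrow> T_op k D \<psi> u g x = T_op k D \<psi> u g y"
  unfolding T_op_def prod_kernel_def by (simp cong: prod.cong)

text \<open>The product of the sums \<open>kernel1 (other k)\<close> plus or minus
  \<open>psibar\<close> is expanded over the subsets \<open>u\<close> of \<open>w\<close>. In the
  term of \<open>u\<close> the kernel depends on the variables of \<open>u\<close> only, and Fubini
  integrates out the others against \<open>psibar\<close>.\<close>

lemma T_op_other: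
  assumes w: "finite w" and p: "1 \<le> p" and g: "g \<in> Lp_psi D \<psi> p w" and x: "\<And>j. j \<in> w \<Longrightarrow> x j \<in> D"
  shows "T_op k D \<psi> w g x
    = (\<Sum>u\<in>Pow w. of_real (ksign k ^ card (w - u)) * T_op (other k) D \<psi> u (pair.marg u (w - u) g) x)"
proof -
  let ?k = "other k"
  have "\<forall>j\<in>w. \<exists>C. AE t in leb D. \<bar>kernel1 ?k D \<psi> (x j) t\<bar> \<le> C * \<psi> t"
    using kernel1_le_psi x by blast
  then obtain C where C: "\<And>j. j \<in> w \<Longrightarrow> AE t in leb D. \<bar>kernel1 ?k D \<psi> (x j) t\<bar> \<le> C j * \<psi> t"
    by metis
  let ?f = "\<lambda>u t. g t * of_real ((\<Prod>j\<in>u. kernel1 ?k D \<psi> (x j) (t j)) * (\<Prod>j\<in>w - u. psibar (t j)))"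
  have fub: "integrable (leb_prod D w) (?f u)"
    "(LINT t|leb_prod D w. ?f u t) = T_op ?k D \<psi> u (pair.marg u (w - u) g) x" if u: "u \<in> Pow w" for u
  proof -
    have uw: "u \<inter> (w - u) = {}" "finite u" "finite (w - u)" and *: "u \<union> (w - u) = w"
      using u w by (auto intro: finite_subset)
    note F = pair.marg_Fubini[OF uw p, unfolded *, of g "\<lambda>j. kernel1 ?k D \<psi> (x j)" C]
      and I = pair.mixed_kernel_integrable[OF uw p, unfolded *, of g "\<lambda>j. kernel1 ?k D \<psi> (x j)" C]
    have h: "g \<in> Lp_space (pair.WM p w) p" "\<And>j. j \<in> u \<Longrightarrow> kernel1 ?k D \<psi> (x j) \<in> borel_measurable (leb D)"
      "\<And>j. j \<in> u \<Longrightarrow> AE t in leb D. \<bar>kernel1 ?k D \<psi> (x j) t\<bar> \<le> C j * \<psi> t"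
      using g u C by (auto simp: Lp_psi_eq intro: kernel1_measurable)
    show "integrable (leb_prod D w) (?f u)" by (rule I) (fact h)+
    have "(LINT t|leb_prod D u. pair.marg u (w - u) g t * of_real (\<Prod>j\<in>u. kernel1 ?k D \<psi> (x j) (t j)))
        = (LINT t|leb_prod D w. ?f u t)" by (rule F) (fact h)+
    then show "(LINT t|leb_prod D w. ?f u t) = T_op ?k D \<psi> u (pair.marg u (w - u) g) x"
      by (simp only: T_op_def prod_kernel_def)
  qed
  have "prod_kernel k D \<psi> w x t = (\<Sum>u\<in>Pow w. ksign k ^ card (w - u) *
      ((\<Prod>j\<in>u. kernel1 ?k D \<psi> (x j) (t j)) * (\<Prod>j\<in>w - u. psibar (t j))))" for t
  proof -
    have "prod_kernel k D \<psi> w x t = (\<Prod>j\<in>w. kernel1 ?k D \<psi> (x j) (t j) + ksign k * psibar (t j))"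
      unfolding prod_kernel_def by (intro prod.cong refl kernel1_other)
    also have "\<dots> = (\<Sum>u\<in>Pow w. (\<Prod>j\<in>u. kernel1 ?k D \<psi> (x j) (t j)) * (\<Prod>j\<in>w - u. ksign k * psibar (t j)))"
      by (rule prod_add[OF w])
    finally show ?thesis by (simp add: prod.distrib mult_ac)
  qed
  then have "T_op k D \<psi> w g x = (LINT t|leb_prod D w. (\<Sum>u\<in>Pow w. of_real (ksign k ^ card (w - u)) * ?f u t))"
    unfolding T_op_def
    by (intro Bochner_Integration.integral_cong refl) (simp add: sum_distrib_left mult_ac)
  also have "\<dots> = (\<Sum>u\<in>Pow w. LINT t|leb_prod D w. of_real (ksign k ^ card (w - u)) * ?f u t)"
    by (intro Bochner_Integration.integral_sum integrable_mult_right fub)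
  also have "\<dots> = (\<Sum>u\<in>Pow w. of_real (ksign k ^ card (w - u)) * (LINT t|leb_prod D w. ?f u t))"
    by (simp only: integral_mult_right_zero)
  also have "\<dots> = (\<Sum>u\<in>Pow w. of_real (ksign k ^ card (w - u)) * T_op ?k D \<psi> u (pair.marg u (w - u) g) x)"
    by (intro sum.cong refl) (simp only: fub(2))
  finally show ?thesis .
qed

lemma marg_empty:
  assumes "x \<in> space (leb_prod D u)"
  shows "pair.marg u {} g x = g x"
proof -
  have "x \<in> extensional u" using assms by (auto simp: space_PiM PiE_iff)
  then have "merge u {} (x, y) = x" for y
    by (auto simp: merge_def extensional_def fun_eq_iff)
  then show ?thesis
    by (simp add: pair.marg_def PiM_empty lebesgue_integral_count_space_finite)
qed

end

section \<open>Transformation of the families of components\<close>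

locale weighted_spaces = weighted_interval +
  fixes d :: nat and \<gamma> :: "nat set \<Rightarrow> real"
  assumes gamma_ge0: "\<And>u. u \<subseteq> {1..d} \<Longrightarrow> \<gamma> u \<ge> 0"
    and gamma_ex: "\<exists>u. u \<subseteq> {1..d} \<and> \<gamma> u \<noteq> 0"
    and gamma_down: "\<And>u w. w \<subseteq> {1..d} \<Longrightarrow> u \<subseteq> w \<Longrightarrow> \<gamma> w > 0 \<Longrightarrow> \<gamma> u > 0"
begin

abbreviation U :: "nat set set" where "U \<equiv> pos_weights d \<gamma>"

lemma U_D: "u \<in> U \<Longrightarrow> u \<subseteq> {1..d}" "u \<in> U \<Longrightarrow> finite u" "u \<in> U \<Longrightarrow> 0 < \<gamma> u"
  by (auto simp: pos_weights_def intro: finite_subset)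

lemma U_down: "w \<in> U \<Longrightarrow> u \<subseteq> w \<Longrightarrow> u \<in> U"
  using gamma_down by (auto simp: pos_weights_def)

lemma finite_U: "finite U"
  by (rule finite_subset[of _ "Pow {1..d}"]) (auto simp: pos_weights_def)

lemma U_nonempty: "U \<noteq> {}"
  using gamma_ex gamma_ge0 by (force simp: pos_weights_def less_le)

text \<open>The components of the same function in the other decomposition: every \<open>g w\<close>
  with \<open>w\<close> containing \<open>u\<close> contributes to the component with index
  \<open>u\<close>.\<close>

definition switch :: "kind \<Rightarrow> (nat set \<Rightarrow> (nat \<Rightarrow> real) \<Rightarrow> complex) \<Rightarrow> nat set \<Rightarrow> (nat \<Rightarrow> real) \<Rightarrow> complex" where
  "switch k g u = (\<lambda>x. \<Sum>w\<in>{w\<in>U. u \<subseteq> w}. of_real (ksign k ^ card (w - u)) * pair.marg u (w - u) (g w) x)"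

lemma marg_Lp_psi:
  assumes p: "1 \<le> p" and h: "h \<in> Lp_psi D \<psi> p w" and w: "w \<in> U" and u: "u \<subseteq> w"
  shows "pair.marg u (w - u) h \<in> Lp_psi D \<psi> p u"
    and "Lp_psi_norm D \<psi> p u (pair.marg u (w - u) h)
      \<le> (\<kappa> ^ card (w - u)) powr recip p * (m ^ card (w - u)) powr (1 - recip p) * Lp_psi_norm D \<psi> p w h"
proof -
  have *: "u \<inter> (w - u) = {}" "finite u" "finite (w - u)" "u \<union> (w - u) = w"
    using U_D(2)[OF w] u by (auto intro: finite_subset)
  from pair.marg_Lp[OF *(1-3) p, of h] h
  show "pair.marg u (w - u) h \<in> Lp_psi D \<psi> p u"
    "Lp_psi_norm D \<psi> p u (pair.marg u (w - u) h)
      \<le> (\<kappa> ^ card (w - u)) powr recip p * (m ^ card (w - u)) powr (1 - recip p) * Lp_psi_norm D \<psi> p w h"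
    unfolding *(4) Lp_psi_eq Lp_psi_norm_eq m_const_def by auto
qed

lemma switch_Lp:
  assumes p: "1 \<le> p" and g: "\<And>w. w \<in> U \<Longrightarrow> g w \<in> Lp_psi D \<psi> p w" and u: "u \<in> U"
  shows "switch k g u \<in> Lp_psi D \<psi> p u \<and> Lp_psi_norm D \<psi> p u (switch k g u) \<le> (\<Sum>w\<in>{w\<in>U. u \<subseteq> w}.
    (\<kappa> ^ card (w - u)) powr recip p * (m ^ card (w - u)) powr (1 - recip p) * Lp_psi_norm D \<psi> p w (g w))"
  unfolding switch_def Lp_psi_eq Lp_psi_norm_eq
proof (intro Lp_sum[OF p])
  fix w assume w: "w \<in> {w\<in>U. u \<subseteq> w}"
  have n: "norm (of_real (ksign k ^ card (w - u)) :: complex) = 1"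
    by (cases k) (simp_all add: norm_power)
  note M = marg_Lp_psi[OF p g[of w], of u, unfolded Lp_psi_eq Lp_psi_norm_eq]
  show "(\<lambda>x. of_real (ksign k ^ card (w - u)) * pair.marg u (w - u) (g w) x) \<in> Lp_space (pair.WM p u) p"
    using M(1) w n by (intro Lp_scale) auto
  have "Lp_norm (pair.WM p u) p (\<lambda>x. of_real (ksign k ^ card (w - u)) * pair.marg u (w - u) (g w) x)
      = Lp_norm (pair.WM p u) p (pair.marg u (w - u) (g w))"
    using M(1) w n by (intro Lp_scale) auto
  then show "Lp_norm (pair.WM p u) p (\<lambda>x. of_real (ksign k ^ card (w - u)) * pair.marg u (w - u) (g w) x)
      \<le> (\<kappa> ^ card (w - u)) powr recip p * (m ^ card (w - u)) powr (1 - recip p) * Lp_norm (pair.WM p w) p (g w)"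
    using M(2) w by simp
qed (simp add: finite_U)

text \<open>Each term is expanded by \<open>T_op_other\<close>, and the two summations are
  exchanged. Since the index set \<open>U\<close> is closed under subsets, the expansion of a term
  with \<open>w\<close> in \<open>U\<close> stays inside \<open>U\<close>; in particular the two
  spaces coincide.\<close>

lemma is_rep_switch:
  assumes p: "1 \<le> p" and rep: "is_rep k D \<psi> p d \<gamma> f g"
  shows "is_rep (other k) D \<psi> p d \<gamma> f (switch k g)"
  unfolding is_rep_def
proof (intro conjI ballI)
  have g: "g w \<in> Lp_psi D \<psi> p w" if "w \<in> U" for w using rep that by (simp add: is_rep_def)
  show "switch k g u \<in> Lp_psi D \<psi> p u" if "u \<in> U" for u
    using switch_Lp[OF p g that] by simp
  have "f = (\<lambda>x\<in>{1..d} \<rightarrow>\<^sub>E D. \<Sum>w\<in>U. T_op k D \<psi> w (g w) x)" using rep by (simp add: is_rep_def)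
  also have "\<dots> = (\<lambda>x\<in>{1..d} \<rightarrow>\<^sub>E D. \<Sum>u\<in>U. T_op (other k) D \<psi> u (switch k g u) x)"
  proof (intro restrict_ext)
    fix x assume x: "x \<in> {1..d} \<rightarrow>\<^sub>E D"
    let ?c = "\<lambda>u w. of_real (ksign k ^ card (w - u)) * T_op (other k) D \<psi> u (pair.marg u (w - u) (g w)) x"
    have xD: "x j \<in> D" if "j \<in> u" "u \<in> U" for j u
      using x U_D(1)[OF that(2)] that(1) by (auto simp: PiE_iff)
    have "(\<Sum>w\<in>U. T_op k D \<psi> w (g w) x) = (\<Sum>w\<in>U. \<Sum>u\<in>{u\<in>U. u \<subseteq> w}. ?c u w)"
    proof (intro sum.cong refl)
      fix w assume w: "w \<in> U"
      have "{u\<in>U. u \<subseteq> w} = Pow w" using U_down[OF w] by auto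
      then show "T_op k D \<psi> w (g w) x = (\<Sum>u\<in>{u\<in>U. u \<subseteq> w}. ?c u w)"
        using T_op_other[OF U_D(2)[OF w] p g[OF w], of x k] xD[OF _ w] by simp
    qed
    also have "\<dots> = (\<Sum>u\<in>U. \<Sum>w\<in>{w\<in>U. u \<subseteq> w}. ?c u w)"
      by (rule sum.swap_restrict[OF finite_U finite_U])
    also have "\<dots> = (\<Sum>u\<in>U. T_op (other k) D \<psi> u (switch k g u) x)"
    proof (intro sum.cong refl)
      fix u assume u: "u \<in> U"
      show "(\<Sum>w\<in>{w\<in>U. u \<subseteq> w}. ?c u w) = T_op (other k) D \<psi> u (switch k g u) x"
        unfolding switch_def
        by (rule T_op_sum[OF U_D(2)[OF u] p, symmetric]) (use marg_Lp_psi(1)[OF p g, of w u for w] xD[OF _ u] in auto)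
    qed
    finally show "(\<Sum>w\<in>U. T_op k D \<psi> w (g w) x) = (\<Sum>u\<in>U. T_op (other k) D \<psi> u (switch k g u) x)" .
  qed
  finally show "f = (\<lambda>x\<in>{1..d} \<rightarrow>\<^sub>E D. \<Sum>u\<in>U. T_op (other k) D \<psi> u (switch k g u) x)" .
qed

section \<open>Uniqueness of the representations\<close>

abbreviation zero_fun :: "(nat \<Rightarrow> real) \<Rightarrow> complex" where
  "zero_fun \<equiv> (\<lambda>x\<in>{1..d} \<rightarrow>\<^sub>E D. 0)"

text \<open>Induction on the size of \<open>u\<close>. At a point whose coordinates outside
  \<open>u\<close> are 0, the terms with \<open>w\<close> not contained in \<open>u\<close> vanish
  because [0,0) is empty, and those of proper subsets vanish by induction. What remains says that
  all box integrals of \<open>g u\<close> are 0.\<close>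

lemma anchored_zero:
  assumes p: "1 \<le> p" and rep: "is_rep Anchored D \<psi> p d \<gamma> zero_fun g" and u: "u \<in> U"
  shows "AE t in leb_prod D u. g u t = 0"
proof -
  have g: "g w \<in> Lp_psi D \<psi> p w" if "w \<in> U" for w using rep that by (simp add: is_rep_def)
  have sum0: "(\<Sum>w\<in>U. T_op Anchored D \<psi> w (g w) x) = 0" if x: "x \<in> {1..d} \<rightarrow>\<^sub>E D" for x
  proof -
    have "zero_fun x = (\<lambda>x\<in>{1..d} \<rightarrow>\<^sub>E D. \<Sum>w\<in>U. T_op Anchored D \<psi> w (g w) x) x"
      using rep unfolding is_rep_def by metis
    with x show ?thesis by simp
  qed
  have T0: "T_op Anchored D \<psi> u (g u) x = 0" if "u \<in> U" "\<And>j. j \<in> u \<Longrightarrow> x j \<in> D" for u x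
    using that
  proof (induction "card u" arbitrary: u x rule: less_induct)
    case less
    define x' where "x' = (\<lambda>j\<in>{1..d}. if j \<in> u then x j else 0)"
    have x': "x' \<in> {1..d} \<rightarrow>\<^sub>E D" using less.prems D_zero by (auto simp: x'_def)
    have "T_op Anchored D \<psi> w (g w) x' = 0" if w: "w \<in> U - {u}" for w
    proof (cases "w \<subseteq> u")
      case True
      with w have "w \<subset> u" by auto
      then have "card w < card u" using U_D(2)[OF less.prems(1)] by (rule psubset_card_mono[rotated])
      moreover have "x' j \<in> D" if "j \<in> w" for j
        using x' that U_D(1)[of w] w by (auto simp: PiE_iff)
      ultimately show ?thesis using less.hyps w by auto
    next
      case False
      then obtain j where j: "j \<in> w" "j \<notin> u" by auto
      then have "j \<in> {1..d}" using U_D(1)[of w] w by auto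
      then have "x' j = 0" using j by (simp add: x'_def)
      then have "prod_kernel Anchored D \<psi> w x' t = 0" for t
        unfolding prod_kernel_def using j U_D(2)[of w] w by (intro prod_zero) (auto intro!: bexI[of _ j])
      then show ?thesis by (simp add: T_op_def)
    qed
    then have "(\<Sum>w\<in>U. T_op Anchored D \<psi> w (g w) x') = T_op Anchored D \<psi> u (g u) x'"
      using less.prems(1) finite_U by (subst sum.remove[of _ u]) auto
    moreover have "T_op Anchored D \<psi> u (g u) x' = T_op Anchored D \<psi> u (g u) x"
      using U_D(1)[OF less.prems(1)] by (intro T_op_cong) (auto simp: x'_def)
    ultimately show ?case using sum0[OF x'] by simp
  qed
  have K: "prod_kernel Anchored D \<psi> u x t = (\<Prod>j\<in>u. indicator {0..<x j} (t j))" for x t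
    by (simp add: prod_kernel_def)
  show ?thesis
  proof (rule AE_zero_if_box_integrals_zero[OF U_D(2)[OF u]])
    fix x assume x: "x \<in> (\<Pi>\<^sub>E j\<in>u. D)"
    show "integrable (leb_prod D u) (\<lambda>t. g u t * of_real (\<Prod>j\<in>u. indicator {0..<x j} (t j)))"
      using T_op_integrable[OF U_D(2)[OF u] p g[OF u], of x Anchored] x unfolding K by (auto simp: PiE_iff)
    show "(LINT t|leb_prod D u. g u t * of_real (\<Prod>j\<in>u. indicator {0..<x j} (t j))) = 0"
      using T0[OF u, of x] x unfolding T_op_def K by (auto simp: PiE_iff)
  qed
qed

text \<open>In the ANOVA case the switched family represents the zero function with anchored kernels
  and hence vanishes almost everywhere. The transformation is triangular for inclusion with identity
  diagonal, so the original components vanish one after another, starting from the largest index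
  sets.\<close>

lemma rep_zero:
  assumes p: "1 \<le> p" and rep: "is_rep k D \<psi> p d \<gamma> zero_fun g" and u: "u \<in> U"
  shows "AE t in leb_prod D u. g u t = 0"
proof (cases k)
  case Anchored
  then show ?thesis using anchored_zero[OF p _ u] rep by simp
next
  case ANOVA
  have s0: "AE t in leb_prod D u. switch k g u t = 0" if "u \<in> U" for u
    using anchored_zero[OF p _ that] is_rep_switch[OF p rep] ANOVA by simp
  show ?thesis
    using u
  \<comment> \<open>Downward induction on the cardinality: strict supersets within {1..d} have a
    smaller difference \<open>d - card w\<close>.\<close>
  proof (induction "d - card u" arbitrary: u rule: less_induct)
    case less
    let ?W = "{w\<in>U. u \<subset> w}"
    have "AE t in leb_prod D u. \<forall>w\<in>?W. pair.marg u (w - u) (g w) t = 0"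
    proof (intro AE_ball_countable[THEN iffD2] ballI)
      fix w assume w: "w \<in> ?W"
      then have wU: "w \<in> U" and "u \<subset> w" by auto
      then have "card u < card w" using U_D(2) by (intro psubset_card_mono) auto
      moreover have "card w \<le> d" using card_mono[OF _ U_D(1)[OF wU]] by simp
      ultimately have "AE t in leb_prod D w. g w t = 0" using less.hyps[of w] wU by simp
      moreover have "u \<union> (w - u) = w" using w by auto
      ultimately show "AE t in leb_prod D u. pair.marg u (w - u) (g w) t = 0"
        using U_D(2)[OF wU] U_D(2)[OF less.prems] by (intro pair.marg_AE_zero) (simp_all only: Diff_disjoint finite_Diff)
    qed (simp add: countable_finite finite_U)
    with s0[OF less.prems] AE_space show ?case
    proof eventually_elim
      case (elim t)
      have "{w\<in>U. u \<subseteq> w} = insert u ?W" using less.prems by auto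
      then have "switch k g u t = pair.marg u {} (g u) t"
        using elim(3) by (simp add: switch_def finite_U)
      with elim(1,2) show ?case by (simp add: marg_empty)
    qed
  qed
qed

lemma rep_unique:
  assumes p: "1 \<le> p" and rep: "is_rep k D \<psi> p d \<gamma> f g" "is_rep k D \<psi> p d \<gamma> f g'" and u: "u \<in> U"
  shows "AE t in leb_prod D u. g u t = g' u t"
proof -
  have g: "g w \<in> Lp_psi D \<psi> p w" "g' w \<in> Lp_psi D \<psi> p w" if "w \<in> U" for w
    using rep that by (simp_all add: is_rep_def)
  have "is_rep k D \<psi> p d \<gamma> zero_fun (\<lambda>u t. g u t - g' u t)"
    unfolding is_rep_def
  proof (intro conjI ballI)
    show "(\<lambda>t. g w t - g' w t) \<in> Lp_psi D \<psi> p w" if "w \<in> U" for w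
      using Lp_diff[OF p] g[OF that] by (simp add: Lp_psi_eq)
    have fx: "f x = (\<Sum>w\<in>U. T_op k D \<psi> w (g w) x)" "f x = (\<Sum>w\<in>U. T_op k D \<psi> w (g' w) x)"
      if "x \<in> {1..d} \<rightarrow>\<^sub>E D" for x
      using rep[unfolded is_rep_def, THEN conjunct2, THEN fun_cong, of x] that by simp_all
    show "zero_fun = (\<lambda>x\<in>{1..d} \<rightarrow>\<^sub>E D. \<Sum>w\<in>U. T_op k D \<psi> w (\<lambda>t. g w t - g' w t) x)"
    proof (intro restrict_ext)
      fix x assume x: "x \<in> {1..d} \<rightarrow>\<^sub>E D"
      have "T_op k D \<psi> w (\<lambda>t. g w t - g' w t) x = T_op k D \<psi> w (g w) x - T_op k D \<psi> w (g' w) x" if w: "w \<in> U" for w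
      proof -
        have "x j \<in> D" if "j \<in> w" for j using x U_D(1)[OF w] that by (auto simp: PiE_iff)
        then show ?thesis
          unfolding T_op_def left_diff_distrib
          by (intro Bochner_Integration.integral_diff T_op_integrable[OF U_D(2)[OF w] p] g w)
      qed
      then show "0 = (\<Sum>w\<in>U. T_op k D \<psi> w (\<lambda>t. g w t - g' w t) x)"
        using fx[OF x] by (simp add: sum_subtractf)
    qed
  qed
  from rep_zero[OF p this u] show ?thesis by simp
qed

text \<open>Uniqueness up to null sets makes the value described in \<open>W_norm\<close> unique, so
  any representation may be used to compute the norm.\<close>

lemma W_norm_eq:
  assumes p: "1 \<le> p" and rep: "is_rep k D \<psi> p d \<gamma> f g"
  shows "W_norm k D \<psi> p q d \<gamma> f = ennreal (family_norm D \<psi> p q d \<gamma> g)"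
proof -
  have uniq: "family_norm D \<psi> p q d \<gamma> g' = family_norm D \<psi> p q d \<gamma> g" if rep': "is_rep k D \<psi> p d \<gamma> f g'" for g'
  proof -
    have eq: "Lp_psi_norm D \<psi> p u (g' u) = Lp_psi_norm D \<psi> p u (g u)" if u: "u \<in> U" for u
      unfolding Lp_psi_norm_eq
    proof (rule Lp_norm_AE_cong)
      show "AE t in pair.WM p u. g' u t = g u t"
        using rep_unique[OF p rep' rep u] by (simp add: pair.AE_WM_iff U_D(2)[OF u])
      have "g u \<in> Lp_space (pair.WM p u) p" "g' u \<in> Lp_space (pair.WM p u) p"
        using rep rep' u by (simp_all add: is_rep_def Lp_psi_eq)
      then show "g' u \<in> borel_measurable (pair.WM p u)" "g u \<in> borel_measurable (pair.WM p u)"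
        by (auto dest: Lp_measurable)
    qed
    have "(\<lambda>u. Lp_psi_norm D \<psi> p u (g' u) / \<gamma> u) ` U = (\<lambda>u. Lp_psi_norm D \<psi> p u (g u) / \<gamma> u) ` U"
      by (intro image_cong) (simp_all add: eq)
    then show ?thesis by (simp add: family_norm_def eq)
  qed
  have "(THE r. \<exists>g. is_rep k D \<psi> p d \<gamma> f g \<and> r = family_norm D \<psi> p q d \<gamma> g) = family_norm D \<psi> p q d \<gamma> g"
    by (rule the_equality) (use rep uniq in blast)+
  moreover have "f \<in> W_space k D \<psi> p d \<gamma>" using rep by (auto simp: W_space_def)
  ultimately show ?thesis by (simp add: W_norm_def)
qed

section \<open>Operator norms as suprema over families of components\<close>

definition unit_families :: "ennreal \<Rightarrow> ennreal \<Rightarrow> (nat set \<Rightarrow> (nat \<Rightarrow> real) \<Rightarrow> complex) set" where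
  "unit_families p q = {g. (\<forall>u\<in>U. g u \<in> Lp_psi D \<psi> p u) \<and> family_norm D \<psi> p q d \<gamma> g \<le> 1}"

text \<open>Functions and families correspond through their representations, and
  \<open>is_rep_switch\<close> keeps the image inside the other space, so the value \<infinity> of
  \<open>W_norm\<close> never occurs. The unit ball of families is the same for both kinds; only the
  map \<open>switch\<close> differs.\<close>

lemma op_norm_eq:
  assumes p: "1 \<le> p"
  shows "op_norm (W_space k D \<psi> p d \<gamma>) (W_norm k D \<psi> p q d \<gamma>) (W_norm (other k) D \<psi> p q d \<gamma>) id
    = (SUP g\<in>unit_families p q. ennreal (family_norm D \<psi> p q d \<gamma> (switch k g)))"
  unfolding op_norm_def id_apply
proof (rule SUP_eq)
  fix f assume "f \<in> {f \<in> W_space k D \<psi> p d \<gamma>. W_norm k D \<psi> p q d \<gamma> f \<le> 1}"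
  then obtain g where rep: "is_rep k D \<psi> p d \<gamma> f g" and "W_norm k D \<psi> p q d \<gamma> f \<le> 1"
    by (auto simp: W_space_def)
  then have "ennreal (family_norm D \<psi> p q d \<gamma> g) \<le> 1"
    by (simp only: W_norm_eq[OF p rep])
  then have "g \<in> unit_families p q"
    using rep by (simp add: unit_families_def is_rep_def)
  then show "\<exists>g\<in>unit_families p q. W_norm (other k) D \<psi> p q d \<gamma> f \<le> ennreal (family_norm D \<psi> p q d \<gamma> (switch k g))"
    using W_norm_eq[OF p is_rep_switch[OF p rep]] by (intro bexI[of _ g]) auto
next
  fix g assume g: "g \<in> unit_families p q"
  define f where "f = (\<lambda>x\<in>{1..d} \<rightarrow>\<^sub>E D. \<Sum>u\<in>U. T_op k D \<psi> u (g u) x)"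
  have rep: "is_rep k D \<psi> p d \<gamma> f g" using g by (simp add: is_rep_def f_def unit_families_def)
  have "f \<in> W_space k D \<psi> p d \<gamma>" using rep by (auto simp: W_space_def)
  moreover have "W_norm k D \<psi> p q d \<gamma> f \<le> 1"
    using g by (simp add: W_norm_eq[OF p rep] unit_families_def)
  ultimately show "\<exists>f\<in>{f \<in> W_space k D \<psi> p d \<gamma>. W_norm k D \<psi> p q d \<gamma> f \<le> 1}.
      ennreal (family_norm D \<psi> p q d \<gamma> (switch k g)) \<le> W_norm (other k) D \<psi> p q d \<gamma> f"
    using W_norm_eq[OF p is_rep_switch[OF p rep]] by (intro bexI[of _ f]) auto
qed

definition alt :: "(nat set \<Rightarrow> (nat \<Rightarrow> real) \<Rightarrow> complex) \<Rightarrow> nat set \<Rightarrow> (nat \<Rightarrow> real) \<Rightarrow> complex" where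
  "alt g u t = (-1) ^ card u * g u t"

lemma family_norm_alt: "family_norm D \<psi> p q d \<gamma> (alt g) = family_norm D \<psi> p q d \<gamma> g"
proof -
  have "Lp_psi_norm D \<psi> p u (alt g u) = Lp_psi_norm D \<psi> p u (g u)" for u
    unfolding Lp_psi_norm_eq by (rule Lp_norm_cong_norm) (simp add: alt_def norm_mult norm_power)
  then show ?thesis by (simp add: family_norm_def)
qed

lemma alt_unit_families:
  assumes "g \<in> unit_families p q"
  shows "alt g \<in> unit_families p q"
proof -
  have "alt g u \<in> Lp_psi D \<psi> p u" if "u \<in> U" for u
    using assms that Lp_scale(1)[of "g u" "pair.WM p u" p "(-1) ^ card u"]
    by (simp add: unit_families_def Lp_psi_eq alt_def[abs_def] norm_power)
  then show ?thesis using assms by (simp add: unit_families_def family_norm_alt)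
qed

text \<open>Factoring (-1)^|w| as (-1)^|u| * (-1)^|w-u|, the second factor turns the signs of one
  direction into those of the other.\<close>

lemma switch_alt:
  "switch (other k) (alt g) u = alt (switch k g) u" if "u \<in> U"
proof
  fix x
  show "switch (other k) (alt g) u x = alt (switch k g) u x"
    unfolding switch_def alt_def sum_distrib_left
  proof (intro sum.cong refl)
    fix w assume w: "w \<in> {w\<in>U. u \<subseteq> w}"
    have "pair.marg u (w - u) (alt g w) x = (-1) ^ card w * pair.marg u (w - u) (g w) x"
      unfolding pair.marg_def alt_def mult.assoc by (rule integral_mult_right_zero)
    moreover have "(-1) ^ card w = (-1) ^ card u * ((-1) ^ card (w - u) :: complex)"
    proof -
      have "card w = card u + card (w - u)"
        using w U_D(2)[of w] by (metis (no_types, lifting) card_Un_disjoint Diff_disjoint Un_Diff_cancel Un_absorb1 finite_Diff finite_subset mem_Collect_eq)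
      then show ?thesis by (simp add: power_add)
    qed
    moreover have "of_real (ksign (other k) ^ card (w - u)) * (-1) ^ card (w - u) = (of_real (ksign k ^ card (w - u)) :: complex)"
      by (cases k) (simp_all flip: power_mult_distrib)
    ultimately show "of_real (ksign (other k) ^ card (w - u)) * pair.marg u (w - u) (\<lambda>t. (-1) ^ card w * g w t) x
      = (-1) ^ card u * (of_real (ksign k ^ card (w - u)) * pair.marg u (w - u) (g w) x)"
      by (simp add: alt_def[abs_def] mult_ac)
  qed
qed

text \<open>The map \<open>alt\<close> preserves the norm and the unit ball and carries one
  \<open>switch\<close> to the other. Each supremum is thus at most the other, with
  \<open>alt g\<close> as witness both times.\<close>

lemma SUP_switch_other:
  "(SUP g\<in>unit_families p q. ennreal (family_norm D \<psi> p q d \<gamma> (switch k g)))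
    = (SUP g\<in>unit_families p q. ennreal (family_norm D \<psi> p q d \<gamma> (switch (other k) g)))"
proof -
  have eq: "family_norm D \<psi> p q d \<gamma> (switch (other k) (alt g)) = family_norm D \<psi> p q d \<gamma> (switch k g)" for g k
  proof -
    have "family_norm D \<psi> p q d \<gamma> (switch (other k) (alt g)) = family_norm D \<psi> p q d \<gamma> (alt (switch k g))"
      unfolding family_norm_def by (simp add: switch_alt cong: image_cong sum.cong)
    then show ?thesis by (simp add: family_norm_alt)
  qed
  show ?thesis
  proof (rule SUP_eq)
    fix g assume g: "g \<in> unit_families p q"
    show "\<exists>g'\<in>unit_families p q. ennreal (family_norm D \<psi> p q d \<gamma> (switch k g)) \<le> ennreal (family_norm D \<psi> p q d \<gamma> (switch (other k) g'))"
      by (intro bexI[of _ "alt g"] alt_unit_families g) (simp add: eq)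
    show "\<exists>g'\<in>unit_families p q. ennreal (family_norm D \<psi> p q d \<gamma> (switch (other k) g)) \<le> ennreal (family_norm D \<psi> p q d \<gamma> (switch k g'))"
      using eq[of "other k" g] by (intro bexI[of _ "alt g"] alt_unit_families g) simp
  qed
qed

lemma iota_norms_eq: "1 \<le> p \<Longrightarrow> iota_norm D \<psi> p q d \<gamma> = iota_inv_norm D \<psi> p q d \<gamma>"
  using op_norm_eq[of p ANOVA q] op_norm_eq[of p Anchored q] SUP_switch_other[of p q ANOVA]
  by (simp add: iota_norm_def iota_inv_norm_def)

lemma iota_norm_leI:
  assumes p: "1 \<le> p" and K: "0 \<le> K"
    and le: "\<And>g. (\<And>u. u \<in> U \<Longrightarrow> g u \<in> Lp_psi D \<psi> p u) \<Longrightarrow>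
      family_norm D \<psi> p q d \<gamma> (switch ANOVA g) \<le> K * family_norm D \<psi> p q d \<gamma> g"
  shows "iota_norm D \<psi> p q d \<gamma> \<le> ennreal K"
proof -
  have "family_norm D \<psi> p q d \<gamma> (switch ANOVA g) \<le> K" if "g \<in> unit_families p q" for g
  proof -
    have "family_norm D \<psi> p q d \<gamma> (switch ANOVA g) \<le> K * family_norm D \<psi> p q d \<gamma> g"
      using that by (intro le) (simp add: unit_families_def)
    also have "\<dots> \<le> K * 1" using that K by (intro mult_left_mono) (simp_all add: unit_families_def)
    finally show ?thesis by simp
  qed
  then show ?thesis
    using op_norm_eq[OF p, of ANOVA q] unfolding iota_norm_def
    by (auto intro!: SUP_least ennreal_leI)
qed

section \<open>The transition matrix and its row and column sums\<close>

lemma family_norm_lq: "family_norm D \<psi> p q d \<gamma> g = lq_norm q U (\<lambda>u. Lp_psi_norm D \<psi> p u (g u) / \<gamma> u)"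
  by (simp add: family_norm_def lq_norm_def)

text \<open>Reindexing by v = w - u. The constant also includes those \<open>v\<close> for which the
  weight of the union is 0; they add only non-negative terms.\<close>

lemma row_sum_le:
  assumes c: "0 \<le> c" and u: "u \<in> U"
  shows "(\<Sum>w\<in>{w\<in>U. u \<subseteq> w}. c ^ card (w - u) * (\<gamma> w / \<gamma> u))
    \<le> Max ((\<lambda>u. \<Sum>v\<in>Pow ({1..d} - u). c ^ card v * (\<gamma> (u \<union> v) / \<gamma> u)) ` Pow {1..d})"
proof -
  have "(\<Sum>w\<in>{w\<in>U. u \<subseteq> w}. c ^ card (w - u) * (\<gamma> w / \<gamma> u))
      = (\<Sum>v\<in>{v\<in>Pow ({1..d} - u). u \<union> v \<in> U}. c ^ card v * (\<gamma> (u \<union> v) / \<gamma> u))"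
    by (rule sum.reindex_bij_witness[of _ "\<lambda>v. u \<union> v" "\<lambda>w. w - u"])
      (use U_D(1) in \<open>auto simp: Un_absorb1 Un_Diff Diff_triv Int_commute\<close>)
  also have "\<dots> \<le> (\<Sum>v\<in>Pow ({1..d} - u). c ^ card v * (\<gamma> (u \<union> v) / \<gamma> u))"
    using c U_D(1,3)[OF u]
    by (intro sum_mono2) (auto intro!: mult_nonneg_nonneg divide_nonneg_pos gamma_ge0)
  also have "\<dots> \<le> Max ((\<lambda>u. \<Sum>v\<in>Pow ({1..d} - u). c ^ card v * (\<gamma> (u \<union> v) / \<gamma> u)) ` Pow {1..d})"
    using U_D(1)[OF u] by (intro Max_ge) auto
  finally show ?thesis .
qed

text \<open>By downward closedness all subsets of \<open>w\<close> belong to \<open>U\<close>, so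
  the column sum equals one of the sums in the maximum.\<close>

lemma column_sum_le:
  assumes c: "0 \<le> c" and w: "w \<in> U"
  shows "(\<Sum>u\<in>{u\<in>U. u \<subseteq> w}. c ^ card (w - u) * (\<gamma> w / \<gamma> u))
    \<le> Max ((\<lambda>v. \<Sum>u\<in>Pow v. c ^ (card v - card u) * (\<gamma> v / \<gamma> u)) ` Pow {1..d})"
proof -
  have "{u\<in>U. u \<subseteq> w} = Pow w" using U_down[OF w] by auto
  then have "(\<Sum>u\<in>{u\<in>U. u \<subseteq> w}. c ^ card (w - u) * (\<gamma> w / \<gamma> u)) = (\<Sum>u\<in>Pow w. c ^ (card w - card u) * (\<gamma> w / \<gamma> u))"
    using U_D(2)[OF w] by (intro sum.cong) (auto simp: card_Diff_subset finite_subset)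
  also have "\<dots> \<le> Max ((\<lambda>v. \<Sum>u\<in>Pow v. c ^ (card v - card u) * (\<gamma> v / \<gamma> u)) ` Pow {1..d})"
    using U_D(1)[OF w] by (intro Max_ge) auto
  finally show ?thesis .
qed

text \<open>The diagonal term is 1. This gives positivity of all four constants, needed for their
  powers with exponent 0.\<close>

lemma one_le_row_and_column_sum:
  assumes c: "0 \<le> c" and u: "u \<in> U"
  shows "1 \<le> (\<Sum>w\<in>{w\<in>U. u \<subseteq> w}. c ^ card (w - u) * (\<gamma> w / \<gamma> u))"
    and "1 \<le> (\<Sum>w\<in>{w\<in>U. w \<subseteq> u}. c ^ card (u - w) * (\<gamma> u / \<gamma> w))"
proof -
  have pos: "0 \<le> c ^ n * (\<gamma> w / \<gamma> v)" if "w \<in> U" "v \<in> U" for n w v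
    using c U_D(3)[OF that(1)] U_D(3)[OF that(2)] by simp
  have "1 = c ^ card (u - u) * (\<gamma> u / \<gamma> u)" using U_D(3)[OF u] by simp
  also have "\<dots> \<le> (\<Sum>w\<in>{w\<in>U. u \<subseteq> w}. c ^ card (w - u) * (\<gamma> w / \<gamma> u))"
    using u finite_U pos by (intro member_le_sum[of u _ "\<lambda>w. c ^ card (w - u) * (\<gamma> w / \<gamma> u)"]) auto
  finally show "1 \<le> (\<Sum>w\<in>{w\<in>U. u \<subseteq> w}. c ^ card (w - u) * (\<gamma> w / \<gamma> u))" .
  have "1 = c ^ card (u - u) * (\<gamma> u / \<gamma> u)" using U_D(3)[OF u] by simp
  also have "\<dots> \<le> (\<Sum>w\<in>{w\<in>U. w \<subseteq> u}. c ^ card (u - w) * (\<gamma> u / \<gamma> w))"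
    using u finite_U pos by (intro member_le_sum[of u _ "\<lambda>w. c ^ card (u - w) * (\<gamma> u / \<gamma> w)"]) auto
  finally show "1 \<le> (\<Sum>w\<in>{w\<in>U. w \<subseteq> u}. c ^ card (u - w) * (\<gamma> u / \<gamma> w))" .
qed

text \<open>The \<kappa>-matrix has row bound \<open>C_1_inf\<close> and column bound
  \<open>C_1_1\<close>; the \<open>m\<close>-matrix has row bound \<open>C_inf_inf\<close> and
  column bound \<open>C_inf_1\<close>.\<close>

sublocale kernels: kernel_pair U "(\<subseteq>)" "\<lambda>u w. \<kappa> ^ card (w - u) * (\<gamma> w / \<gamma> u)"
  "\<lambda>u w. m ^ card (w - u) * (\<gamma> w / \<gamma> u)"
  "C_1_inf D \<psi> d \<gamma>" "C_1_1 D \<psi> d \<gamma>" "C_inf_inf D \<psi> d \<gamma>" "C_inf_1 D \<psi> d \<gamma>"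
proof
  obtain u where u: "u \<in> U" using U_nonempty by auto
  note R = order_trans[OF one_le_row_and_column_sum(1)[OF _ u] row_sum_le[OF _ u]]
    and C = order_trans[OF one_le_row_and_column_sum(2)[OF _ u] column_sum_le[OF _ u]]
  show "0 < C_1_inf D \<psi> d \<gamma>" "0 < C_1_1 D \<psi> d \<gamma>" "0 < C_inf_inf D \<psi> d \<gamma>" "0 < C_inf_1 D \<psi> d \<gamma>"
    using R[OF kappa_nonneg kappa_nonneg] C[OF kappa_nonneg kappa_nonneg] R[OF m_nonneg m_nonneg] C[OF m_nonneg m_nonneg]
    by (auto simp: C_1_inf_def C_1_1_def C_inf_inf_def C_inf_1_def)
next
  fix u assume u: "u \<in> U"
  show "(\<Sum>w\<in>{w\<in>U. u \<subseteq> w}. \<kappa> ^ card (w - u) * (\<gamma> w / \<gamma> u)) \<le> C_1_inf D \<psi> d \<gamma>"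
    unfolding C_1_inf_def by (rule row_sum_le[OF kappa_nonneg u])
  show "(\<Sum>w\<in>{w\<in>U. u \<subseteq> w}. m ^ card (w - u) * (\<gamma> w / \<gamma> u)) \<le> C_inf_inf D \<psi> d \<gamma>"
    unfolding C_inf_inf_def by (rule row_sum_le[OF m_nonneg u])
  show "(\<Sum>w\<in>{w\<in>U. w \<subseteq> u}. \<kappa> ^ card (u - w) * (\<gamma> u / \<gamma> w)) \<le> C_1_1 D \<psi> d \<gamma>"
    unfolding C_1_1_def by (rule column_sum_le[OF kappa_nonneg u])
  show "(\<Sum>w\<in>{w\<in>U. w \<subseteq> u}. m ^ card (u - w) * (\<gamma> u / \<gamma> w)) \<le> C_inf_1 D \<psi> d \<gamma>"
    unfolding C_inf_1_def by (rule column_sum_le[OF m_nonneg u])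
qed (use finite_U U_nonempty U_D(3) kappa_pos m_pos in auto)

lemma switch_entry_bound:
  assumes p: "1 \<le> p" and g: "\<And>w. w \<in> U \<Longrightarrow> g w \<in> Lp_psi D \<psi> p w" and u: "u \<in> U"
  shows "Lp_psi_norm D \<psi> p u (switch k g u) / \<gamma> u \<le> (\<Sum>w\<in>{w\<in>U. u \<subseteq> w}.
    (\<kappa> ^ card (w - u) * (\<gamma> w / \<gamma> u)) powr recip p * (m ^ card (w - u) * (\<gamma> w / \<gamma> u)) powr (1 - recip p)
      * (Lp_psi_norm D \<psi> p w (g w) / \<gamma> w))"
proof -
  have "Lp_psi_norm D \<psi> p u (switch k g u) / \<gamma> u \<le> (\<Sum>w\<in>{w\<in>U. u \<subseteq> w}.
    (\<kappa> ^ card (w - u)) powr recip p * (m ^ card (w - u)) powr (1 - recip p) * Lp_psi_norm D \<psi> p w (g w)) / \<gamma> u"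
    using switch_Lp[OF p g u] U_D(3)[OF u] by (intro divide_right_mono) auto
  also have "\<dots> = (\<Sum>w\<in>{w\<in>U. u \<subseteq> w}.
    (\<kappa> ^ card (w - u) * (\<gamma> w / \<gamma> u)) powr recip p * (m ^ card (w - u) * (\<gamma> w / \<gamma> u)) powr (1 - recip p)
      * (Lp_psi_norm D \<psi> p w (g w) / \<gamma> w))"
    unfolding sum_divide_distrib
  proof (intro sum.cong refl)
    fix w assume w: "w \<in> {w\<in>U. u \<subseteq> w}"
    let ?r = "\<gamma> w / \<gamma> u"
    have r: "0 < \<gamma> w" "0 < \<gamma> u" "0 < ?r" using w u U_D(3) by auto
    \<comment> \<open>The ratio of the weights is distributed over both matrices as c = c^a *
      c^(1-a), with a = 1/p.\<close>
    have "(K * c) powr a * (L * c) powr (1 - a) = K powr a * L powr (1 - a) * c"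
      if "0 \<le> K" "0 \<le> L" "0 < c" for K L c a :: real
    proof -
      have "c powr a * c powr (1 - a) = c" using that by (simp flip: powr_add)
      with that show ?thesis by (simp add: powr_mult)
    qed
    then have "(\<kappa> ^ card (w - u) * ?r) powr recip p * (m ^ card (w - u) * ?r) powr (1 - recip p)
        = (\<kappa> ^ card (w - u)) powr recip p * (m ^ card (w - u)) powr (1 - recip p) * ?r"
      using r kappa_nonneg m_nonneg by (simp only: zero_le_power)
    then show "(\<kappa> ^ card (w - u)) powr recip p * (m ^ card (w - u)) powr (1 - recip p) * Lp_psi_norm D \<psi> p w (g w) / \<gamma> u
      = (\<kappa> ^ card (w - u) * ?r) powr recip p * (m ^ card (w - u) * ?r) powr (1 - recip p)
        * (Lp_psi_norm D \<psi> p w (g w) / \<gamma> w)"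
      using r by simp
  qed
  finally show ?thesis .
qed

lemma Lp_psi_norm_div_ge0: "u \<in> U \<Longrightarrow> 0 \<le> Lp_psi_norm D \<psi> p u h / \<gamma> u"
  using U_D(3)[of u] by (simp add: Lp_psi_norm_def Lp_norm_nonneg)

lemma iota_norm_le_if_p_le_q:
  assumes p: "1 \<le> p" and pq: "p \<le> q"
  shows "iota_norm D \<psi> p q d \<gamma> \<le> ennreal (C_1_inf D \<psi> d \<gamma> powr (recip p - recip q) *
    C_1_1 D \<psi> d \<gamma> powr recip q * C_inf_inf D \<psi> d \<gamma> powr (1 - recip p))"
  by (rule iota_norm_leI[OF p], simp, unfold family_norm_lq,
      rule kernels.lq_bound_le[OF p pq])
      (erule Lp_psi_norm_div_ge0 | rule switch_entry_bound[OF p] | assumption)+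

lemma iota_norm_le_if_q_le_p:
  assumes q: "1 \<le> q" and qp: "q \<le> p"
  shows "iota_norm D \<psi> p q d \<gamma> \<le> ennreal (C_inf_1 D \<psi> d \<gamma> powr (recip q - recip p) *
    C_1_1 D \<psi> d \<gamma> powr recip p * C_inf_inf D \<psi> d \<gamma> powr (1 - recip q))"
proof -
  have p: "1 \<le> p" using q qp by simp
  show ?thesis
    by (rule iota_norm_leI[OF p], simp, unfold family_norm_lq,
      rule kernels.lq_bound_ge[OF q qp])
      (erule Lp_psi_norm_div_ge0 | rule switch_entry_bound[OF p] | assumption)+
qed

end

theorem theorem18:
  fixes D :: "real set" and \<psi> :: "real \<Rightarrow> real" and d :: nat
    and \<gamma> :: "nat set \<Rightarrow> real" and p q :: ennreal
  assumes "interval_dom D"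
    and "prob_density_on D \<psi>"
    and "integrability_cond D \<psi> 1"
    and "d \<ge> 1"
    and "\<And>u. u \<subseteq> {1..d} \<Longrightarrow> \<gamma> u \<ge> 0"
    and "\<exists>u. u \<subseteq> {1..d} \<and> \<gamma> u \<noteq> 0"
    and "\<And>u w. w \<subseteq> {1..d} \<Longrightarrow> u \<subseteq> w \<Longrightarrow> \<gamma> w > 0 \<Longrightarrow> \<gamma> u > 0"
  shows "(1 \<le> p \<and> p \<le> q \<longrightarrow>
            iota_norm D \<psi> p q d \<gamma> = iota_inv_norm D \<psi> p q d \<gamma> \<and>
            iota_norm D \<psi> p q d \<gamma> \<le>
              ennreal (C_1_inf D \<psi> d \<gamma> powr (recip p - recip q) *
                       C_1_1 D \<psi> d \<gamma> powr recip q *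
                       C_inf_inf D \<psi> d \<gamma> powr (1 - recip p))) \<and>
         (1 \<le> q \<and> q \<le> p \<longrightarrow>
            iota_norm D \<psi> p q d \<gamma> = iota_inv_norm D \<psi> p q d \<gamma> \<and>
            iota_norm D \<psi> p q d \<gamma> \<le>
              ennreal (C_inf_1 D \<psi> d \<gamma> powr (recip q - recip p) *
                       C_1_1 D \<psi> d \<gamma> powr recip p *
                       C_inf_inf D \<psi> d \<gamma> powr (1 - recip q)))"
proof -
  interpret weighted_spaces D \<psi> d \<gamma>
    by unfold_locales (fact assms)+
  show ?thesis
    using iota_norms_eq iota_norm_le_if_p_le_q iota_norm_le_if_q_le_p by (meson order_trans)
qed

end
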